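(* Let $r\ge 1$ be a fixed integer, $\mu=\frac{1}{r+1}$ and $\sigma^2=\frac{r(r+2)}{6(r+1)^2}$. Then, as $n\to\infty$, the size $X_{n,r}$ of the $r$-fold leaf-cut random plane tree with $n$ nodes is, after standardization, asymptotically normally distributed: $$\frac{X_{n,r}-\mu n}{\sqrt{\sigma^2 n}}\xrightarrow{\ d\ }\mathcal{N}(0,1).$$ More precisely, for $x\in\mathbb{R}$, $$\mathbb{P}\Bigl(\frac{X_{n,r}-\mu n}{\sqrt{\sigma^2 n}}\le x\Bigr)=\frac{1}{\sqrt{2\pi}}\int_{-\infty}^x e^{-t^2/2}\,dt+O(n^{-1/2}),$$ where the $O$-constant depends only on $r$. The same statements hold with $X_{n,r}$ replaced by $I_{n,r-1}$.
   Context: A plane tree is a finite rooted tree in which the children of every node are linearly ordered; its size is its number of nodes. A leaf is a node without children (the single-node tree consists of one leaf); all other nodes are inner nodes. For a plane tree $\tau$ with at least two nodes, $\rho(\tau)$ is the plane tree obtained by simultaneously deleting all leaves of $\tau$; $\rho$ is not defined on the single-node tree. Let $\tau$ be chosen uniformly at random among all plane trees of size $n$. $X_{n,r}$ is the size of $\rho^r(\tau)$ and $I_{n,r}$ is the number of inner nodes of $\rho^r(\tau)$; if $\rho^r(\tau)$ is not defined, both are $0$. *)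

theory Defs
  imports "HOL-Probability.Probability"
begin

datatype plane_tree = Node (children: "plane_tree list")

definition is_leaf :: "plane_tree \<Rightarrow> bool" where
  "is_leaf t \<longleftrightarrow> children t = []"

primrec tree_size :: "plane_tree \<Rightarrow> nat" where
  "tree_size (Node ts) = 1 + sum_list (map tree_size ts)"

primrec inner_nodes :: "plane_tree \<Rightarrow> nat" where
  "inner_nodes (Node ts) =
     (if is_leaf (Node ts) then 0 else 1) + sum_list (map inner_nodes ts)"

text \<open>
  In a recursive call the value \<open>None\<close> says that the subtree is a single leaf, so it is dropped
  from the list of children; the order of the remaining children is kept.
  Nodes that become leaves by this are not deleted.
\<close>

primrec cut_leaves :: "plane_tree \<Rightarrow> plane_tree option" where
  "cut_leaves (Node ts) =
     (if is_leaf (Node ts) then None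
      else Some (Node (List.map_filter id (map cut_leaves ts))))"

primrec cut_leaves_iter :: "nat \<Rightarrow> plane_tree \<Rightarrow> plane_tree option" where
  "cut_leaves_iter 0 t = Some t"
| "cut_leaves_iter (Suc r) t = Option.bind (cut_leaves_iter r t) cut_leaves"

definition cut_size :: "nat \<Rightarrow> plane_tree \<Rightarrow> nat" where
  "cut_size r t = (case cut_leaves_iter r t of None \<Rightarrow> 0 | Some t' \<Rightarrow> tree_size t')"

definition cut_inner_nodes :: "nat \<Rightarrow> plane_tree \<Rightarrow> nat" where
  "cut_inner_nodes r t = (case cut_leaves_iter r t of None \<Rightarrow> 0 | Some t' \<Rightarrow> inner_nodes t')"

definition plane_trees :: "nat \<Rightarrow> plane_tree set" where
  "plane_trees n = {t. tree_size t = n}"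

text \<open>
  Only meaningful for \<open>n \<ge> 1\<close>, since there is no plane tree of size \<open>0\<close>.
\<close>

definition random_plane_tree :: "nat \<Rightarrow> plane_tree pmf" where
  "random_plane_tree n = pmf_of_set (plane_trees n)"

lemma tree_size_pos: "tree_size t \<ge> 1"
  by (cases t) simp

lemma finite_plane_trees: "finite (plane_trees n)"
proof (induction n rule: less_induct)
  case (less n)
  define A where "A = (\<Union>m<n. plane_trees m)"
  have "finite A"
    unfolding A_def using less by blast
  have "t \<in> Node ` {ts. set ts \<subseteq> A \<and> length ts \<le> n}" if "t \<in> plane_trees n" for t
  proof (cases t)
    case (Node ts)
    have n: "n = 1 + sum_list (map tree_size ts)"
      using that Node by (simp add: plane_trees_def)
    have "tree_size u < n" if "u \<in> set ts" for u
      using member_le_sum_list[of "tree_size u" "map tree_size ts"] that n by simp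
    moreover have "length ts \<le> sum_list (map tree_size ts)"
      using sum_list_mono[of ts "\<lambda>_. 1" tree_size] tree_size_pos by (simp add: sum_list_triv)
    ultimately show ?thesis
      using Node n by (auto simp: A_def plane_trees_def)
  qed
  then have "plane_trees n \<subseteq> Node ` {ts. set ts \<subseteq> A \<and> length ts \<le> n}"
    by blast
  then show ?case
    using finite_lists_length_le[OF \<open>finite A\<close>] by (meson finite_imageI finite_subset)
qed

lemma plane_trees_nonempty:
  assumes "n \<ge> 1"
  shows "plane_trees n \<noteq> {}"
proof -
  have "tree_size (Node (replicate (n - 1) (Node []))) = n"
    using assms by (simp add: sum_list_replicate)
  then show ?thesis
    unfolding plane_trees_def by blast
qed

lemma set_random_plane_tree: "n \<ge> 1 \<Longrightarrow> set_pmf (random_plane_tree n) = plane_trees n"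
  by (simp add: random_plane_tree_def finite_plane_trees plane_trees_nonempty)

end

theory Submission
  imports Defs "HOL-Complex_Analysis.Complex_Analysis"
begin

text \<open>
  The size of the \<open>r\<close>-fold cut tree is the number of nodes whose subtree has height at
  least \<open>r\<close>, so it satisfies a recursion at the root. With \<open>L\<close> the (rational) generating function of the
  trees that are cut away completely, the bivariate generating function \<open>G\<close> is the solution of
  \<open>G = v z / (1 - G) + (1 - v) L\<close>, hence \<open>(1 + (1 - v) L - 2 G)\<^sup>2 = (1 - (1 - v) L)\<^sup>2 - 4 v z\<close>.
  For \<open>v\<close> near \<open>1\<close> the right-hand side has exactly one zero \<open>\<rho>(v)\<close> in a disc of radius greater than
  \<open>1/4\<close>, so the \<open>n\<close>-th coefficient of \<open>G\<close> is \<open>O(\<bar>\<rho>(v)\<bar> powr (- n) * n powr (- 3/2))\<close>, uniformly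
  in \<open>v\<close>. Therefore
  \<open>E(exp(s X)) (4 \<rho>(e\<^sup>s))\<^sup>n\<close> is a bounded sequence of holomorphic functions of \<open>s\<close> near \<open>0\<close> with value
  \<open>1\<close> at \<open>0\<close>, thus \<open>1 + O(\<bar>s\<bar>)\<close>; no finer asymptotics is needed. The expansion
  \<open>ln (4 \<rho>(e\<^sup>s)) = - \<mu> s - \<sigma>\<^sup>2 s\<^sup>2 / 2 + O(s\<^sup>3)\<close> and Esseen's smoothing inequality give the rate.
\<close>

section \<open>Cutting leaves and the root decomposition\<close>

text \<open>Upper bounds suffice because the number of trees is known exactly: it is
  \<open>4 ^ n * cmod (1/2 gchoose n) / 2\<close>, and the coefficient bound carries the same
  binomial factor, so the quotient is bounded with no asymptotics of either side. Cauchy's estimate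
  then gives the error \<open>O(cmod s)\<close>, and on the scale
  \<open>s = \<i> * t / (\<sigma> * sqrt n)\<close> of the characteristic function this is already
  of order \<open>n powr (- 1/2)\<close>. The squared equation determines the square root only up to
  sign; since only moduli of coefficients are estimated, no branch has to be identified. The zero of
  the discriminant is not found by counting zeros: the linear factor is divided out, and the
  quotient stays close to 4. The value 1/4 is critical because \<open>l = z / (1 - l)\<close> has
  the double solution \<open>l = 1/2\<close> there. The iterates from 0 stay strictly below 1/2 at
  this point, which leaves room for a larger disc. Their value and derivative at 1/4 alone determine
  \<open>\<mu>\<close> and \<open>\<sigma>2\<close>.\<close>

lemma map_filter_id_bind:
  "List.map_filter id (map f (List.map_filter id (map g xs)))
   = List.map_filter id (map (\<lambda>x. Option.bind (g x) f) xs)"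
  by (induction xs) (auto simp: List.map_filter_simps split: option.splits)

lemma map_filter_id_eq_Nil_iff:
  "List.map_filter id (map f xs) = [] \<longleftrightarrow> (\<forall>x\<in>set xs. f x = None)"
  by (induction xs) (auto simp: List.map_filter_simps split: option.splits)

text \<open>The definition iterates cuts of the whole tree, whereas generating functions need a
  recursion at the root. Two indices occur: the root survives \<open>Suc r\<close> cuts iff some
  child survives \<open>r\<close> cuts, but the children still present afterwards are those that
  survive \<open>Suc r\<close> cuts.\<close>

lemma cut_leaves_iter_Suc_Node:
  "cut_leaves_iter (Suc r) (Node ts) =
     (if \<forall>t\<in>set ts. cut_leaves_iter r t = None then None
      else Some (Node (List.map_filter id (map (cut_leaves_iter (Suc r)) ts))))"
proof (induction r)
  case 0
  then show ?case by (auto simp: is_leaf_def id_def)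
next
  case (Suc r)
  show ?case
  proof (cases "\<forall>t\<in>set ts. cut_leaves_iter r t = None")
    case True
    then show ?thesis using Suc by simp
  next
    case False
    have "cut_leaves_iter (Suc (Suc r)) (Node ts) = Option.bind (cut_leaves_iter (Suc r) (Node ts)) cut_leaves"
      by (rule cut_leaves_iter.simps(2))
    also have "\<dots> = cut_leaves (Node (List.map_filter id (map (cut_leaves_iter (Suc r)) ts)))"
      using Suc False by simp
    also have "\<dots> = (if \<forall>t\<in>set ts. cut_leaves_iter (Suc r) t = None then None
        else Some (Node (List.map_filter id (map (\<lambda>t. Option.bind (cut_leaves_iter (Suc r) t) cut_leaves) ts))))"
      by (simp only: cut_leaves.simps is_leaf_def plane_tree.sel map_filter_id_eq_Nil_iff map_filter_id_bind)
    finally show ?thesis by (simp only: cut_leaves_iter.simps(2))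
  qed
qed

text \<open>If the root disappears, every child is gone after \<open>r\<close> cuts already, so the
  sum over the children vanishes as well; otherwise the root contributes one node.\<close>

lemma cut_size_Suc_Node:
  "cut_size (Suc r) (Node ts) =
     (if cut_leaves_iter (Suc r) (Node ts) = None then 0 else 1) + sum_list (map (cut_size (Suc r)) ts)"
proof -
  have sum: "sum_list (map tree_size (List.map_filter id (map (cut_leaves_iter (Suc r)) ts)))
      = sum_list (map (cut_size (Suc r)) ts)"
    by (induction ts) (auto simp: List.map_filter_simps cut_size_def split: option.splits)
  show ?thesis
  proof (cases "\<forall>t\<in>set ts. cut_leaves_iter r t = None")
    case True
    then have "\<forall>t\<in>set ts. cut_size (Suc r) t = 0"
      by (simp add: cut_size_def)
    then have "sum_list (map (cut_size (Suc r)) ts) = 0"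
      by (simp add: sum_list_eq_0_iff)
    then show ?thesis
      using True cut_leaves_iter_Suc_Node[of r ts] by (simp add: cut_size_def)
  next
    case False
    then have "cut_leaves_iter (Suc r) (Node ts) = Some (Node (List.map_filter id (map (cut_leaves_iter (Suc r)) ts)))"
      using cut_leaves_iter_Suc_Node[of r ts] by argo
    then show ?thesis
      unfolding sum[symmetric] by (simp add: cut_size_def del: cut_leaves_iter.simps)
  qed
qed

text \<open>One cut removes the leaves and nothing else; for the single leaf both sides are 0. This
  reduces the claim about inner nodes after \<open>r - 1\<close> cuts to the one about sizes after
  \<open>r\<close> cuts.\<close>

lemma inner_nodes_eq_tree_size_cut:
  "inner_nodes t = (case cut_leaves t of None \<Rightarrow> 0 | Some t' \<Rightarrow> tree_size t')"
proof (induction t)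
  case (Node ts)
  have "sum_list (map tree_size (List.map_filter id (map cut_leaves ts))) = sum_list (map inner_nodes ts)"
    using Node by (induction ts) (auto simp: List.map_filter_simps split: option.splits)
  then show ?case by (auto simp: is_leaf_def)
qed

lemma cut_inner_nodes_eq_cut_size: "cut_inner_nodes r t = cut_size (Suc r) t"
  by (simp add: cut_inner_nodes_def cut_size_def inner_nodes_eq_tree_size_cut split: option.splits)

section \<open>Generating functions\<close>

definition plane_forests :: "nat \<Rightarrow> plane_tree list set" where
  "plane_forests n = {ts. sum_list (map tree_size ts) = n}"

definition tree_gf :: "(plane_tree \<Rightarrow> 'a :: comm_ring_1) \<Rightarrow> 'a fps" where
  "tree_gf w = Abs_fps (\<lambda>n. \<Sum>t\<in>plane_trees n. w t)"

definition forest_gf :: "(plane_tree \<Rightarrow> 'a :: comm_ring_1) \<Rightarrow> 'a fps" where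
  "forest_gf w = Abs_fps (\<lambda>n. \<Sum>ts\<in>plane_forests n. prod_list (map w ts))"

lemma plane_trees_Suc: "plane_trees (Suc n) = Node ` plane_forests n"
proof -
  have "t \<in> Node ` plane_forests n" if "tree_size t = Suc n" for t
    using that by (cases t) (auto simp: plane_forests_def)
  then show ?thesis by (auto simp: plane_trees_def plane_forests_def)
qed

lemma plane_trees_0: "plane_trees 0 = {}"
  using tree_size_pos by (force simp: plane_trees_def Suc_le_eq)

lemma inj_Node: "inj_on Node A"
  by (auto simp: inj_on_def)

lemma finite_plane_forests: "finite (plane_forests n)"
  using finite_plane_trees[of "Suc n"] finite_image_iff[OF inj_Node] by (simp add: plane_trees_Suc)

lemma plane_forests_0: "plane_forests 0 = {[]}"
proof -
  have "ts = []" if "sum_list (map tree_size ts) = 0" for ts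
    using that tree_size_pos[of "hd ts"] by (cases ts) auto
  then show ?thesis by (auto simp: plane_forests_def)
qed

text \<open>Splits off the first tree. The union is restricted to \<open>k \<le> n\<close> to keep
  the index set finite.\<close>

lemma plane_forests_pos:
  assumes "n > 0"
  shows "plane_forests n = (\<lambda>(t, ts). t # ts) ` (SIGMA t:(\<Union>k\<le>n. plane_trees k). plane_forests (n - tree_size t))"
    (is "_ = ?R")
proof
  show "plane_forests n \<subseteq> ?R"
  proof
    fix ts assume ts: "ts \<in> plane_forests n"
    then obtain u us where "ts = u # us"
      using assms by (cases ts) (auto simp: plane_forests_def)
    with ts show "ts \<in> ?R"
      by (auto simp: plane_forests_def plane_trees_def image_iff)
  qed
  show "?R \<subseteq> plane_forests n"
    by (auto simp: plane_forests_def plane_trees_def)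
qed

text \<open>A forest is empty or a first tree followed by a forest, and weights multiply: a
  geometric series in \<open>tree_gf w\<close>.\<close>

lemma forest_gf_eq: "forest_gf w = 1 + tree_gf w * forest_gf w"
proof (rule fps_ext)
  fix n
  show "fps_nth (forest_gf w) n = fps_nth (1 + tree_gf w * forest_gf w) n"
  proof (cases "n = 0")
    case True
    then show ?thesis
      by (simp add: forest_gf_def tree_gf_def plane_forests_0 plane_trees_0)
  next
    case False
    have "fps_nth (forest_gf w) n
        = (\<Sum>(t, ts)\<in>(SIGMA t:(\<Union>k\<le>n. plane_trees k). plane_forests (n - tree_size t)). w t * prod_list (map w ts))"
      unfolding forest_gf_def fps_nth_Abs_fps using False
      by (subst plane_forests_pos)
        (auto simp: sum.reindex inj_on_def case_prod_unfold intro!: sum.cong)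
    also have "\<dots> = (\<Sum>t\<in>(\<Union>k\<le>n. plane_trees k). w t * fps_nth (forest_gf w) (n - tree_size t))"
      by (subst sum.Sigma[symmetric])
        (auto simp: finite_plane_trees finite_plane_forests forest_gf_def sum_distrib_left)
    also have "\<dots> = (\<Sum>k\<le>n. \<Sum>t\<in>plane_trees k. w t * fps_nth (forest_gf w) (n - tree_size t))"
      by (rule sum.UNION_disjoint) (simp_all add: finite_plane_trees, auto simp: plane_trees_def)
    also have "\<dots> = (\<Sum>k\<le>n. fps_nth (tree_gf w) k * fps_nth (forest_gf w) (n - k))"
      by (intro sum.cong refl) (simp add: tree_gf_def sum_distrib_right, simp add: plane_trees_def)
    finally show ?thesis
      using False by (simp add: fps_mult_nth atMost_atLeast0)
  qed
qed

text \<open>A tree is a root over a forest, so \<open>tree_gf w'\<close> is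
  \<open>fps_X / (1 - tree_gf w)\<close>; the product form avoids division over a general
  commutative ring. The two weights may differ, as they do for \<open>Suc r\<close> and
  \<open>r\<close> cuts.\<close>

lemma tree_gf_prod_list:
  assumes "\<And>ts. w' (Node ts) = prod_list (map w ts)"
  shows "tree_gf w' * (1 - tree_gf w) = fps_X"
proof -
  have "tree_gf w' = fps_X * forest_gf w"
  proof (rule fps_ext)
    fix n show "fps_nth (tree_gf w') n = fps_nth (fps_X * forest_gf w) n"
      by (cases n) (auto simp: tree_gf_def forest_gf_def plane_trees_0 plane_trees_Suc
          sum.reindex inj_Node assms)
  qed
  moreover have "forest_gf w * (1 - tree_gf w) = 1"
    using forest_gf_eq[of w] by (simp add: algebra_simps)
  ultimately show ?thesis by (simp add: mult.assoc)
qed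

text \<open>These are the trees of height less than \<open>r\<close>; \<open>low_tree_gf_Suc\<close>
  builds up their classical finite continued fraction.\<close>

definition low_tree_gf :: "nat \<Rightarrow> 'a :: comm_ring_1 fps" where
  "low_tree_gf r = tree_gf (\<lambda>t. if cut_leaves_iter r t = None then 1 else 0)"

definition cut_size_gf :: "nat \<Rightarrow> 'a :: comm_ring_1 \<Rightarrow> 'a fps" where
  "cut_size_gf r v = tree_gf (\<lambda>t. v ^ cut_size r t)"

lemma low_tree_gf_0: "low_tree_gf 0 = 0"
  by (simp add: low_tree_gf_def tree_gf_def fps_eq_iff)

lemma low_tree_gf_Suc: "low_tree_gf (Suc r) * (1 - low_tree_gf r) = (fps_X :: 'a :: comm_ring_1 fps)"
  unfolding low_tree_gf_def
proof (rule tree_gf_prod_list)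
  fix ts
  have "prod_list (map (\<lambda>t. if cut_leaves_iter r t = None then 1 else 0) ts)
      = (if \<forall>t\<in>set ts. cut_leaves_iter r t = None then 1 else 0 :: 'a)"
    by (induction ts) auto
  then show "(if cut_leaves_iter (Suc r) (Node ts) = None then 1 else 0 :: 'a)
      = prod_list (map (\<lambda>t. if cut_leaves_iter r t = None then 1 else 0) ts)"
    using cut_leaves_iter_Suc_Node[of r ts] by simp
qed

text \<open>
  Up to the root, \<open>v ^ cut_size r\<close> is multiplicative over the children; the factor \<open>v\<close> of the root is
  wrong only for trees that are cut away completely, where all weights are \<open>1\<close>.
\<close>

lemma cut_size_gf_eq:
  fixes v :: "'a :: comm_ring_1"
  assumes "r \<ge> 1"
  defines "G \<equiv> cut_size_gf r v" and "L \<equiv> low_tree_gf r"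
  shows "(1 + fps_const (1 - v) * L - 2 * G)\<^sup>2 = (1 - fps_const (1 - v) * L)\<^sup>2 - 4 * fps_const v * fps_X"
proof -
  \<comment> \<open>\<open>Q\<close> weights only the subtrees below the root, which makes it
    \<open>fps_X / (1 - G)\<close>; the factor of the root itself is restored by
    \<open>split\<close>.\<close>
  define Q :: "'a fps" where "Q = tree_gf (\<lambda>t. prod_list (map (\<lambda>u. v ^ cut_size r u) (children t)))"
  obtain r' where r: "r = Suc r'"
    using assms(1) by (cases r) auto
  have "Q * (1 - G) = fps_X"
    unfolding Q_def G_def cut_size_gf_def by (rule tree_gf_prod_list) simp
  moreover have "G = fps_const v * Q + fps_const (1 - v) * L"
  proof -
    have split: "v ^ cut_size r t = v * prod_list (map (\<lambda>u. v ^ cut_size r u) (children t))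
        + (1 - v) * (if cut_leaves_iter r t = None then 1 else 0)" for t
    proof (cases t)
      case (Node ts)
      have pow: "v ^ sum_list (map (cut_size r) us) = prod_list (map (\<lambda>u. v ^ cut_size r u) us)" for us
        by (induction us) (auto simp: power_add)
      show ?thesis
      proof (cases "cut_leaves_iter r t = None")
        case True
        then have "cut_size r t = 0" by (simp add: cut_size_def)
        moreover from this have "sum_list (map (cut_size r) ts) = 0"
          using cut_size_Suc_Node[of r' ts] unfolding r Node by (metis add_is_0)
        then have "prod_list (map (\<lambda>u. v ^ cut_size r u) ts) = 1"
          using pow[of ts] by (metis power_0)
        ultimately show ?thesis using True Node by simp
      next
        case False
        then have "cut_size r t = 1 + sum_list (map (cut_size r) ts)"
          using cut_size_Suc_Node[of r' ts] unfolding Node r by presburger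
        moreover have "(if cut_leaves_iter r t = None then 1 else 0 :: 'a) = 0"
          using False by simp
        ultimately show ?thesis
          unfolding Node plane_tree.sel pow[symmetric] by (simp only: power_add power_one_right) simp
      qed
    qed
    have "(\<Sum>t\<in>plane_trees n. v ^ cut_size r t)
        = v * (\<Sum>t\<in>plane_trees n. prod_list (map (\<lambda>u. v ^ cut_size r u) (children t)))
        + (1 - v) * (\<Sum>t\<in>plane_trees n. if cut_leaves_iter r t = None then 1 else 0)" for n
      unfolding sum_distrib_left sum.distrib[symmetric] by (intro sum.cong refl split)
    then show ?thesis
      by (simp add: fps_eq_iff G_def cut_size_gf_def Q_def L_def low_tree_gf_def tree_gf_def)
  qed
  ultimately have *: "G * (1 - G) = fps_const v * fps_X + fps_const (1 - v) * L * (1 - G)"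
    by (metis distrib_right mult.assoc)
  \<comment> \<open>Completing the square: the premise says
    \<open>G\<^sup>2 - (1 + W) * G + V * X + W = 0\<close>, with discriminant \<open>(1 + W)\<^sup>2
    - 4 * (V * X + W) = (1 - W)\<^sup>2 - 4 * V * X\<close>.\<close>
  have "(1 + W - 2 * G)\<^sup>2 = (1 - W)\<^sup>2 - 4 * V * X"
    if "G * (1 - G) = V * X + W * (1 - G)" for W V X :: "'a fps"
  proof -
    have "(1 + W - 2 * G)\<^sup>2 = (1 + W)\<^sup>2 - 4 * (G * (1 - G)) - 4 * W * G"
      by (simp add: power2_eq_square algebra_simps)
    also have "\<dots> = (1 - W)\<^sup>2 - 4 * V * X"
      unfolding that by (simp add: power2_eq_square algebra_simps)
    finally show ?thesis .
  qed
  from this[OF *] show ?thesis .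
qed

section \<open>The dominant singularity\<close>

text \<open>The rational function with power series \<open>low_tree_gf r\<close> at 0. The discs
  used below contain no zero of a denominator.\<close>

primrec low_tree_fun :: "nat \<Rightarrow> complex \<Rightarrow> complex" where
  "low_tree_fun 0 z = 0"
| "low_tree_fun (Suc r) z = z / (1 - low_tree_fun r z)"

text \<open>The threshold for \<open>c\<close> is the value at 1/4. A bound \<open>d\<close> for
  \<open>low_tree_fun r\<close> yields the bound \<open>cmod z / (1 - d)\<close> for the next
  function, which is at most \<open>c\<close> while \<open>cmod z \<le> c * (1 - d)\<close>. This
  radius still exceeds 1/4 if \<open>d\<close> is close enough to the previous threshold
  \<open>p\<close>; each step spends a part of the slack.\<close>

lemma low_tree_fun_bound:
  assumes "c > real r / (2 * (real r + 1))"
  shows "\<exists>R>1/4. low_tree_fun r holomorphic_on ball 0 R \<and> (\<forall>z\<in>ball 0 R. cmod (low_tree_fun r z) \<le> c)"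
  using assms
proof (induction r arbitrary: c)
  case 0
  then show ?case by (intro exI[of _ 1]) auto
next
  case (Suc r)
  define p where "p = real r / (2 * (real r + 1))"
  have p: "0 \<le> p" "p < 1 / 2" "(1 / 4) / (1 - p) = real (Suc r) / (2 * (real (Suc r) + 1))"
    by (auto simp: p_def field_simps)
  have c: "c * (1 - p) > 1 / 4"
    using Suc.prems p(2) pos_divide_less_eq[of "1 - p" "1 / 4" c] unfolding p(3)[symmetric] by simp
  have "((\<lambda>d. c * (1 - d)) \<longlongrightarrow> c * (1 - p)) (at_right p)"
    by (intro tendsto_intros)
  then have "eventually (\<lambda>d. c * (1 - d) > 1 / 4) (at_right p)"
    using c by (rule order_tendstoD)
  moreover have "eventually (\<lambda>d. d < 1 / 2) (at_right p)"
    using p by (intro eventually_at_right_less[THEN eventually_mono, of p] order_tendstoD(2)[OF tendsto_ident_at]) auto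
  moreover have "eventually (\<lambda>d. d > p) (at_right p)"
    by (rule eventually_at_right_less)
  ultimately have "eventually (\<lambda>d. c * (1 - d) > 1 / 4 \<and> d < 1 / 2 \<and> d > p) (at_right p)"
    by (simp add: eventually_conj_iff)
  then obtain d where d: "c * (1 - d) > 1 / 4" "d < 1 / 2" "d > p"
    using eventually_happens'[OF trivial_limit_at_right_real] by blast
  obtain R where R: "R > 1 / 4" "low_tree_fun r holomorphic_on ball 0 R"
      "\<And>z. z \<in> ball 0 R \<Longrightarrow> cmod (low_tree_fun r z) \<le> d"
    using Suc.IH[of d] d(3) unfolding p_def by auto
  define R' where "R' = min R (c * (1 - d))"
  have denom: "1 - d \<le> cmod (1 - low_tree_fun r z)" if "z \<in> ball 0 R" for z
    using R(3)[OF that] norm_triangle_ineq2[of 1 "low_tree_fun r z"] by simp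
  have ne: "low_tree_fun r z \<noteq> 1" if "z \<in> ball 0 R" for z
    using denom[OF that] d by auto
  show ?case
  proof (intro exI[of _ R'] conjI ballI)
    show "R' > 1 / 4" using R d by (simp add: R'_def)
    have "low_tree_fun r holomorphic_on ball 0 R'"
      using R(2) by (rule holomorphic_on_subset) (auto simp: R'_def)
    then show "low_tree_fun (Suc r) holomorphic_on ball 0 R'"
      unfolding low_tree_fun.simps by (intro holomorphic_intros) (use ne in \<open>auto simp: R'_def\<close>)
    fix z :: complex assume z: "z \<in> ball 0 R'"
    have "cmod (low_tree_fun (Suc r) z) = cmod z / cmod (1 - low_tree_fun r z)"
      by (simp add: norm_divide)
    also have "\<dots> \<le> (c * (1 - d)) / (1 - d)"
      using z denom[of z] d by (intro frac_le) (auto simp: R'_def)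
    also have "\<dots> = c" using d by simp
    finally show "cmod (low_tree_fun (Suc r) z) \<le> c" .
  qed
qed

lemma low_tree_gf_nth_0: "fps_nth (low_tree_gf r) 0 = 0"
  by (simp add: low_tree_gf_def tree_gf_def plane_trees_0)

lemma low_tree_fun_has_fps_expansion: "low_tree_fun r has_fps_expansion low_tree_gf r"
proof (induction r)
  case 0
  then show ?case by (simp add: low_tree_gf_0 has_fps_expansion_0)
next
  case (Suc r)
  have "(\<lambda>z. z / (1 - low_tree_fun r z)) has_fps_expansion fps_X / (1 - low_tree_gf r)"
    by (intro has_fps_expansion_divide' fps_expansion_intros Suc.IH) (simp add: low_tree_gf_nth_0)
  also have "fps_X / (1 - low_tree_gf r) = (low_tree_gf (Suc r) :: complex fps)"
  proof -
    have "(1 - low_tree_gf r :: complex fps) \<noteq> 0"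
    proof
      assume "1 - low_tree_gf r = (0 :: complex fps)"
      then have "fps_nth (1 - low_tree_gf r :: complex fps) 0 = 0" by simp
      then show False by (simp add: low_tree_gf_nth_0)
    qed
    then show ?thesis
      by (simp flip: low_tree_gf_Suc[of r])
  qed
  finally show ?case by simp
qed

lemma low_tree_fun_quarter: "low_tree_fun r (1/4) = of_real (real r / (2 * (real r + 1)))"
proof (induction r)
  case (Suc r)
  have "low_tree_fun (Suc r) (1/4) = of_real ((1/4) / (1 - real r / (2 * (real r + 1))))"
    by (simp only: low_tree_fun.simps Suc of_real_divide of_real_diff of_real_1 of_real_numeral)
  also have "(1/4) / (1 - real r / (2 * (real r + 1))) = real (Suc r) / (2 * (real (Suc r) + 1))"
    by (simp add: field_simps)
  finally show ?case .
qed simp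

text \<open>Differentiating the recursion maps \<open>l'\<close> to
  \<open>((1 - l) + l' / 4) / (1 - l)\<^sup>2\<close>, which this closed form solves. Together with
  \<open>low_tree_fun_quarter\<close> it is all the local information that enters mean and
  variance.\<close>

lemma low_tree_fun_deriv_quarter:
  "(low_tree_fun r has_field_derivative of_real (2 * real r * (real r + 2) / (3 * (real r + 1)))) (at (1/4))"
proof (induction r)
  case (Suc r)
  define l l' where "l = real r / (2 * (real r + 1))" and "l' = 2 * real r * (real r + 2) / (3 * (real r + 1))"
  have l: "low_tree_fun r (1/4) = of_real l"
    unfolding l_def by (rule low_tree_fun_quarter)
  have one_minus_l: "1 - l = (real r + 2) / (2 * (real r + 1))"
    by (simp add: l_def field_simps)
  have "l \<noteq> 1" by (simp add: l_def field_simps)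
  then have "((\<lambda>z. z / (1 - low_tree_fun r z)) has_field_derivative
      (1 * (1 - low_tree_fun r (1/4)) - (1/4) * (0 - of_real l'))
        / ((1 - low_tree_fun r (1/4)) * (1 - low_tree_fun r (1/4)))) (at (1/4))"
    by (intro DERIV_divide DERIV_ident DERIV_diff DERIV_const Suc[folded l'_def]) (simp add: l)
  also have "(1 * (1 - low_tree_fun r (1/4)) - (1/4) * (0 - of_real l'))
        / ((1 - low_tree_fun r (1/4)) * (1 - low_tree_fun r (1/4)))
      = of_real (((1 - l) + l' / 4) / ((1 - l) * (1 - l)))"
    by (simp add: l)
  also have "((1 - l) + l' / 4) / ((1 - l) * (1 - l))
      = 2 * real (Suc r) * (real (Suc r) + 2) / (3 * (real (Suc r) + 1))"
    unfolding one_minus_l l'_def by (simp add: divide_simps) (simp add: algebra_simps)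
  finally show ?case by (simp only: low_tree_fun.simps)
qed simp

lemma analytic_low_tree_fun_quarter: "low_tree_fun r analytic_on {1/4}"
proof -
  obtain R where "R > 1/4" "low_tree_fun r holomorphic_on ball 0 R"
    using low_tree_fun_bound[of r 1] by (auto simp: field_simps)
  then show ?thesis
    unfolding analytic_at by (intro exI[of _ "ball 0 R"]) auto
qed

text \<open>
  The equation for the singularity is quadratic in \<open>sqrt v\<close>, so \<open>s = ln v\<close> is an explicit function
  \<open>\<sigma>\<close> of the singularity, which is then inverted locally.
\<close>

lemma singularity_exists:
  assumes "r \<ge> 1" "R > 1/4"
  shows "\<exists>\<epsilon>>0. \<exists>\<phi>. \<phi> holomorphic_on ball 0 \<epsilon> \<and> \<phi> 0 = 0 \<and>
    (\<forall>s\<in>ball 0 \<epsilon>. cmod (exp (\<phi> s) / 4) < R \<and>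
        (1 - (1 - exp s) * low_tree_fun r (exp (\<phi> s) / 4))\<^sup>2 = exp s * exp (\<phi> s))"
proof -
  define l where "l = low_tree_fun r"
  define l0 where "l0 = real r / (2 * (real r + 1))"
  have l_quarter: "l (1/4) = of_real l0"
    by (simp add: l_def l0_def low_tree_fun_quarter)
  have l0: "l0 \<noteq> 0" "2 * l0 \<noteq> 1"
    using assms(1) by (auto simp: l0_def field_simps)
  \<comment> \<open>The radicand of the second root in \<open>q\<close> is a positive real at 1/4,
    so the principal branch is analytic there, and its root is known in closed form.\<close>
  have disc: "1/4 - l (1/4) * (1 - l (1/4)) = of_real ((1 / (2 * (real r + 1)))\<^sup>2)"
  proof -
    have "1/4 - l0 * (1 - l0) = (1 / (2 * (real r + 1)))\<^sup>2"
      unfolding l0_def by (simp add: power2_eq_square divide_simps) (simp add: algebra_simps)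
    moreover have "1/4 - l (1/4) * (1 - l (1/4)) = of_real (1/4 - l0 * (1 - l0))"
      by (simp add: l_quarter)
    ultimately show ?thesis by (simp only:)
  qed
  \<comment> \<open>\<open>q\<close> stands for \<open>sqrt v\<close>: the equation
    \<open>1 - (1 - q\<^sup>2) * l = 2 * q * sqrt z\<close> is quadratic in \<open>q\<close>, and
    the minus sign picks the root with \<open>q (1/4) = 1\<close>, that is,
    \<open>v = 1\<close>.\<close>
  define q where "q z = (csqrt z - csqrt (z - l z * (1 - l z))) / l z" for z
  define \<sigma> where "\<sigma> z = 2 * Ln (q z)" for z
  have csqrt_quarter: "csqrt (1/4) = 1/2"
    using csqrt_of_real_nonneg[of "1/4"] by (simp add: real_sqrt_divide)
  have csqrt_disc: "csqrt (1/4 - l (1/4) * (1 - l (1/4))) = of_real (1 / (2 * (real r + 1)))"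
    unfolding disc by (subst csqrt_of_real_nonneg) (auto simp: real_sqrt_divide)
  have q_quarter: "q (1/4) = 1"
  proof -
    have "1/2 - 1 / (2 * (real r + 1)) = l0"
      by (simp add: l0_def field_simps)
    moreover have "(1/2 :: complex) - of_real (1 / (2 * (real r + 1))) = of_real (1/2 - 1 / (2 * (real r + 1)))"
      by simp
    ultimately have "(1/2 :: complex) - of_real (1 / (2 * (real r + 1))) = of_real l0"
      by (simp only:)
    then show ?thesis
      unfolding q_def csqrt_disc using l0(1) by (simp only: csqrt_quarter l_quarter) simp
  qed
  have nonpos: "complex_of_real x \<notin> \<real>\<^sub>\<le>\<^sub>0" if "x > 0" for x
    using that by (simp add: complex_nonpos_Reals_iff)
  have an_l: "l analytic_on {1/4}"
    unfolding l_def by (rule analytic_low_tree_fun_quarter)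
  have an_q: "q analytic_on {1/4}"
  proof -
    have "(1/4 :: complex) \<notin> \<real>\<^sub>\<le>\<^sub>0"
      using nonpos[of "1/4"] by simp
    moreover have "1/4 - l (1/4) * (1 - l (1/4)) \<notin> \<real>\<^sub>\<le>\<^sub>0"
      unfolding disc by (rule nonpos) simp
    ultimately show ?thesis
      unfolding q_def using l0(1) l_quarter
      by (intro analytic_intros an_l) (metis singletonD of_real_eq_0_iff)+
  qed
  have an_\<sigma>: "\<sigma> analytic_on {1/4}"
    unfolding \<sigma>_def by (intro analytic_intros an_q) (simp add: q_quarter)
  have \<sigma>_quarter: "\<sigma> (1/4) = 0"
    by (simp add: \<sigma>_def q_quarter)
  have isCont_l: "isCont l (1/4)" and isCont_q: "isCont q (1/4)"
    using an_l an_q by (auto intro!: analytic_at_imp_isCont)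
  have "eventually (\<lambda>z. l z \<noteq> 0) (nhds (1/4))"
    using isCont_l[unfolded isCont_def tendsto_at_iff_tendsto_nhds] l0(1) l_quarter
    by (intro tendsto_imp_eventually_ne[of l "l (1/4)"]) auto
  moreover have "eventually (\<lambda>z. q z \<noteq> 0) (nhds (1/4))"
    using isCont_q[unfolded isCont_def tendsto_at_iff_tendsto_nhds] q_quarter
    by (intro tendsto_imp_eventually_ne[of q "q (1/4)"]) auto
  ultimately have ev: "eventually (\<lambda>z. (1 - (1 - exp (\<sigma> z)) * l z)\<^sup>2 = 4 * exp (\<sigma> z) * z) (nhds (1/4))"
  proof eventually_elim
    case (elim z)
    have exp_\<sigma>: "exp (\<sigma> z) = (q z)\<^sup>2"
      using elim by (simp add: \<sigma>_def exp_double)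
    define d where "d = csqrt (z - l z * (1 - l z))"
    have d2: "d\<^sup>2 = z - l z * (1 - l z)" by (simp add: d_def)
    have c2: "(csqrt z)\<^sup>2 = z" by simp
    have ql: "q z * l z = csqrt z - d"
      using elim by (simp add: q_def d_def)
    have "1 - (1 - (q z)\<^sup>2) * l z = 2 * q z * csqrt z"
    proof -
      have "(l z) * (1 - (1 - (q z)\<^sup>2) * l z) = l z * (1 - l z) + (q z * l z)\<^sup>2"
        by (simp add: algebra_simps power2_eq_square)
      also have "\<dots> = 2 * (csqrt z - d) * csqrt z"
        unfolding ql using d2 c2 by (simp add: algebra_simps power2_eq_square)
      also have "\<dots> = l z * (2 * q z * csqrt z)"
        by (simp flip: ql)
      finally show ?thesis using elim by simp
    qed
    then have "(1 - (1 - (q z)\<^sup>2) * l z)\<^sup>2 = 4 * (q z)\<^sup>2 * (csqrt z)\<^sup>2"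
      by (simp add: power_mult_distrib)
    then show ?case by (simp add: exp_\<sigma>)
  qed
  obtain B where B: "open B" "1/4 \<in> B" "\<sigma> holomorphic_on B"
    using an_\<sigma> by (auto simp: analytic_at)
  obtain B' where B': "open B'" "1/4 \<in> B'"
      "\<And>z. z \<in> B' \<Longrightarrow> (1 - (1 - exp (\<sigma> z)) * l z)\<^sup>2 = 4 * exp (\<sigma> z) * z"
    using ev unfolding eventually_nhds by auto
  \<comment> \<open>Were the derivative 0, the two sides of \<open>ev\<close> would have the
    different derivatives 0 and 4 at 1/4, because \<open>1 - exp (\<sigma> z)\<close> vanishes there
    to second order.\<close>
  have "deriv \<sigma> (1/4) \<noteq> 0"
  proof
    assume "deriv \<sigma> (1/4) = 0"
    then have D\<sigma>: "(\<sigma> has_field_derivative 0) (at (1/4))"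
      using holomorphic_derivI[OF B(3,1,2)] by simp
    obtain l' where Dl: "(l has_field_derivative l') (at (1/4))"
      unfolding l_def using low_tree_fun_deriv_quarter by blast
    have "((\<lambda>z. (1 - (1 - exp (\<sigma> z)) * l z)\<^sup>2) has_field_derivative 0) (at (1/4))"
      using D\<sigma> Dl by (auto intro!: derivative_eq_intros simp: \<sigma>_quarter)
    moreover have "((\<lambda>z. 4 * exp (\<sigma> z) * z) has_field_derivative 4) (at (1/4))"
      using D\<sigma> by (auto intro!: derivative_eq_intros simp: \<sigma>_quarter)
    then have "((\<lambda>z. (1 - (1 - exp (\<sigma> z)) * l z)\<^sup>2) has_field_derivative 4) (at (1/4))"
      by (subst DERIV_cong_ev[OF refl ev refl])
    ultimately show False using DERIV_unique by fastforce
  qed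
  \<comment> \<open>The radius 1/4 keeps the real part of the inverse function positive, so that its
    principal logarithm is holomorphic; the radius \<open>R - 1/4\<close> keeps its modulus below
    \<open>R\<close>.\<close>
  moreover define U where "U = B \<inter> B' \<inter> ball (1/4) (min (1/4) (R - 1/4))"
  have U: "open U" "1/4 \<in> U" "\<sigma> holomorphic_on U"
    using B B' assms(2) by (auto simp: U_def intro: holomorphic_on_subset)
  ultimately obtain d where d: "d > 0" "ball (1/4) d \<subseteq> U" "inj_on \<sigma> (ball (1/4) d)"
    using has_complex_derivative_locally_injective[OF U(3,2,1)] by blast
  have hol: "\<sigma> holomorphic_on ball (1/4) d"
    using U(3) d(2) by (rule holomorphic_on_subset)
  obtain g where g: "g holomorphic_on (\<sigma> ` ball (1/4) d)" "\<And>z. z \<in> ball (1/4) d \<Longrightarrow> g (\<sigma> z) = z"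
    using holomorphic_has_inverse[OF hol open_ball d(3)] by metis
  have "open (\<sigma> ` ball (1/4) d)"
    by (rule open_mapping_thm3[OF hol open_ball d(3)])
  moreover have "0 \<in> \<sigma> ` ball (1/4) d"
    using d(1) \<sigma>_quarter by (metis centre_in_ball image_eqI)
  ultimately obtain \<epsilon> where \<epsilon>: "\<epsilon> > 0" "ball 0 \<epsilon> \<subseteq> \<sigma> ` ball (1/4) d"
    by (auto simp: open_contains_ball)
  define \<phi> where "\<phi> s = Ln (4 * g s)" for s
  have gs: "g s \<in> U \<and> \<sigma> (g s) = s" if "s \<in> ball 0 \<epsilon>" for s
    using that \<epsilon>(2) d(2) g(2) by force
  have Re_gs: "Re (g s) > 0" "cmod (g s) < R" if "s \<in> ball 0 \<epsilon>" for s
  proof -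
    have "cmod (1/4 - g s) < min (1/4) (R - 1/4)"
      using gs[OF that] by (auto simp: U_def dist_norm)
    then show "Re (g s) > 0" "cmod (g s) < R"
      using abs_Re_le_cmod[of "1/4 - g s"] norm_triangle_ineq2[of "g s" "1/4"]
      by (auto simp: norm_minus_commute)
  qed
  have g_nonpos: "4 * g s \<notin> \<real>\<^sub>\<le>\<^sub>0" if "s \<in> ball 0 \<epsilon>" for s
    using Re_gs(1)[OF that] by (simp add: complex_nonpos_Reals_iff)
  have exp_\<phi>: "exp (\<phi> s) = 4 * g s" if "s \<in> ball 0 \<epsilon>" for s
  proof -
    have "4 * g s \<noteq> 0" using g_nonpos[OF that] by auto
    then show ?thesis unfolding \<phi>_def by (rule exp_Ln)
  qed
  have "g 0 = 1/4"
    using g(2)[of "1/4"] d(1) unfolding \<sigma>_quarter by simp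
  have hol_g: "g holomorphic_on ball 0 \<epsilon>"
    using g(1) \<epsilon>(2) by (rule holomorphic_on_subset)
  show ?thesis
  proof (intro exI[of _ \<epsilon>] exI[of _ \<phi>] conjI ballI)
    show "\<phi> holomorphic_on ball 0 \<epsilon>"
      unfolding \<phi>_def
      by (intro holomorphic_intros hol_g) (rule g_nonpos)
    show "\<phi> 0 = 0" unfolding \<phi>_def \<open>g 0 = 1/4\<close> by simp
    fix s :: complex assume s: "s \<in> ball 0 \<epsilon>"
    show "cmod (exp (\<phi> s) / 4) < R"
      using Re_gs(2)[OF s] exp_\<phi>[OF s] by simp
    have "g s \<in> B'" "\<sigma> (g s) = s"
      using gs[OF s] by (auto simp: U_def)
    then show "(1 - (1 - exp s) * low_tree_fun r (exp (\<phi> s) / 4))\<^sup>2 = exp s * exp (\<phi> s)"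
      using B'(3)[of "g s"] exp_\<phi>[OF s] by (simp add: l_def)
  qed (use \<epsilon> in auto)
qed

text \<open>Implicit differentiation, twice, of the equation for the singularity at
  \<open>s = 0\<close>. As \<open>1 - exp s\<close> vanishes there, only \<open>lam 0\<close> and
  \<open>deriv lam 0\<close> enter, and the latter is the derivative at 1/4 times
  \<open>deriv \<phi> 0 / 4\<close> by the chain rule.\<close>

lemma singularity_derivs:
  assumes "\<epsilon> > 0" and \<phi>: "\<phi> holomorphic_on ball 0 \<epsilon>" "\<phi> 0 = 0"
    and R: "low_tree_fun r holomorphic_on ball 0 R" "\<And>s. s \<in> ball 0 \<epsilon> \<Longrightarrow> cmod (exp (\<phi> s) / 4) < R"
    and sing: "\<And>s. s \<in> ball 0 \<epsilon> \<Longrightarrow> (1 - (1 - exp s) * low_tree_fun r (exp (\<phi> s) / 4))\<^sup>2 = exp s * exp (\<phi> s)"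
  shows "deriv \<phi> 0 = - of_real (1 / (real r + 1))"
    and "deriv (deriv \<phi>) 0 = - of_real (real r * (real r + 2) / (6 * (real r + 1)\<^sup>2))"
proof -
  define lam where "lam s = low_tree_fun r (exp (\<phi> s) / 4)" for s
  define l0 where "l0 = real r / (2 * (real r + 1))"
  define l1 where "l1 = 2 * real r * (real r + 2) / (3 * (real r + 1))"
  have lam_0: "lam 0 = of_real l0"
    unfolding lam_def l0_def \<phi>(2) using low_tree_fun_quarter[of r] by simp
  have "low_tree_fun r \<circ> (\<lambda>s. exp (\<phi> s) / 4) holomorphic_on ball 0 \<epsilon>"
    using R \<phi>(1) by (intro holomorphic_on_compose_gen[of _ _ _ "ball 0 R"] holomorphic_intros) auto
  then have hol_lam: "lam holomorphic_on ball 0 \<epsilon>"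
    by (simp add: lam_def[abs_def] o_def)
  have D\<phi>: "(\<phi> has_field_derivative deriv \<phi> s) (at s)"
    and Dlam: "(lam has_field_derivative deriv lam s) (at s)"
    and DD\<phi>: "(deriv \<phi> has_field_derivative deriv (deriv \<phi>) s) (at s)"
    and DDlam: "(deriv lam has_field_derivative deriv (deriv lam) s) (at s)"
    if "s \<in> ball 0 \<epsilon>" for s
    using that by (auto intro!: holomorphic_derivI[of _ "ball 0 \<epsilon>"] holomorphic_deriv \<phi> hol_lam)
  have 0: "0 \<in> ball (0 :: complex) \<epsilon>" using assms(1) by simp
  have eq1: "2 * (1 - (1 - exp s) * lam s) * (exp s * lam s - (1 - exp s) * deriv lam s)
      = exp s * exp (\<phi> s) * (1 + deriv \<phi> s)" if s: "s \<in> ball 0 \<epsilon>" for s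
  proof -
    have "((\<lambda>s. (1 - (1 - exp s) * lam s)\<^sup>2) has_field_derivative
        2 * (1 - (1 - exp s) * lam s) * (exp s * lam s - (1 - exp s) * deriv lam s)) (at s)"
      by (rule derivative_eq_intros Dlam[OF s] refl)+ (simp add: algebra_simps)
    moreover have "((\<lambda>s. exp s * exp (\<phi> s)) has_field_derivative exp s * exp (\<phi> s) * (1 + deriv \<phi> s)) (at s)"
      by (rule derivative_eq_intros D\<phi>[OF s] refl)+ (simp add: algebra_simps)
    then have "((\<lambda>s. (1 - (1 - exp s) * lam s)\<^sup>2) has_field_derivative exp s * exp (\<phi> s) * (1 + deriv \<phi> s)) (at s)"
      by (rule has_field_derivative_transform_within_open[OF _ open_ball s])
        (simp add: lam_def sing)
    ultimately show ?thesis by (rule DERIV_unique)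
  qed
  have "2 * lam 0 = 1 + deriv \<phi> 0"
    using eq1[OF 0] by (simp add: \<phi>(2))
  then have d1: "deriv \<phi> 0 = of_real (2 * l0 - 1)"
    by (simp add: lam_0 algebra_simps)
  also have "2 * l0 - 1 = - (1 / (real r + 1))"
    by (simp add: l0_def field_simps)
  finally show d1': "deriv \<phi> 0 = - of_real (1 / (real r + 1))" by simp
  have "((\<lambda>s. 2 * (1 - (1 - exp s) * lam s) * (exp s * lam s - (1 - exp s) * deriv lam s)) has_field_derivative
      2 * (lam 0 * lam 0 + (lam 0 + 2 * deriv lam 0))) (at 0)"
    by (rule derivative_eq_intros Dlam[OF 0] DDlam[OF 0] refl)+ (simp add: algebra_simps)
  moreover have "((\<lambda>s. exp s * exp (\<phi> s) * (1 + deriv \<phi> s)) has_field_derivative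
      (1 + deriv \<phi> 0)\<^sup>2 + deriv (deriv \<phi>) 0) (at 0)"
    by (rule derivative_eq_intros D\<phi>[OF 0] DD\<phi>[OF 0] refl)+ (simp add: \<phi>(2) power2_eq_square algebra_simps)
  then have "((\<lambda>s. 2 * (1 - (1 - exp s) * lam s) * (exp s * lam s - (1 - exp s) * deriv lam s)) has_field_derivative
      (1 + deriv \<phi> 0)\<^sup>2 + deriv (deriv \<phi>) 0) (at 0)"
    by (rule has_field_derivative_transform_within_open[OF _ open_ball 0]) (rule eq1[symmetric])
  ultimately have eq2: "2 * (lam 0 * lam 0 + (lam 0 + 2 * deriv lam 0)) = (1 + deriv \<phi> 0)\<^sup>2 + deriv (deriv \<phi>) 0"
    by (rule DERIV_unique)
  have "(low_tree_fun r has_field_derivative of_real l1) (at (exp (\<phi> 0) / 4))"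
    using low_tree_fun_deriv_quarter[of r] by (simp add: \<phi>(2) l1_def)
  moreover have "((\<lambda>s. exp (\<phi> s) / 4) has_field_derivative deriv \<phi> 0 / 4) (at 0)"
    by (rule derivative_eq_intros D\<phi>[OF 0] refl)+ (simp_all add: \<phi>(2))
  ultimately have "(lam has_field_derivative of_real l1 * (deriv \<phi> 0 / 4)) (at 0)"
    unfolding lam_def by (rule DERIV_chain2)
  then have "deriv lam 0 = of_real (l1 * (2 * l0 - 1) / 4)"
    by (simp add: DERIV_imp_deriv d1)
  with eq2 have "deriv (deriv \<phi>) 0 = of_real (2 * (l0 * l0 + (l0 + 2 * (l1 * (2 * l0 - 1) / 4))) - (2 * l0)\<^sup>2)"
    by (simp add: lam_0 d1)
  also have "2 * (l0 * l0 + (l0 + 2 * (l1 * (2 * l0 - 1) / 4))) - (2 * l0)\<^sup>2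
      = - (real r * (real r + 2) / (6 * (real r + 1)\<^sup>2))"
    unfolding l0_def l1_def by (simp add: divide_simps power2_eq_square) (simp add: algebra_simps)
  finally show "deriv (deriv \<phi>) 0 = - of_real (real r * (real r + 2) / (6 * (real r + 1)\<^sup>2))"
    by simp
qed

lemma holomorphic_Taylor_2:
  assumes "\<epsilon> > 0" "f holomorphic_on ball 0 \<epsilon>" "0 < d" "d < \<epsilon>"
  obtains B where "B \<ge> 0"
    "\<And>s. s \<in> cball 0 d \<Longrightarrow> cmod (f s - (f 0 + deriv f 0 * s + deriv (deriv f) 0 * s\<^sup>2 / 2)) \<le> B * cmod s ^ 3"
proof -
  have hol: "(deriv ^^ i) f holomorphic_on ball 0 \<epsilon>" for i
    using assms(2) by (rule holomorphic_higher_deriv) simp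
  have sub: "cball 0 d \<subseteq> ball (0 :: complex) \<epsilon>" using assms by auto
  have "continuous_on (cball 0 d) ((deriv ^^ 3) f)"
    by (rule continuous_on_subset[OF holomorphic_on_imp_continuous_on[OF hol[of 3]] sub])
  then have "bounded ((deriv ^^ 3) f ` cball 0 d)"
    by (intro compact_imp_bounded compact_continuous_image) auto
  then obtain B where B: "\<And>s. s \<in> cball 0 d \<Longrightarrow> cmod ((deriv ^^ 3) f s) \<le> B"
    unfolding bounded_iff by blast
  have "0 \<le> B" using order_trans[OF norm_ge_zero B[of 0]] assms(3) by simp
  show ?thesis
  proof (rule that[of "B / 2"])
    fix s :: complex assume s: "s \<in> cball 0 d"
    have "cmod ((deriv ^^ 0) f s - (\<Sum>i\<le>2. (deriv ^^ i) f 0 * (s - 0) ^ i / fact i)) \<le> B * cmod (s - 0) ^ Suc 2 / fact 2"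
    proof (rule complex_Taylor[where S = "cball 0 d"])
      fix i and x :: complex assume "x \<in> cball 0 d"
      then show "((deriv ^^ i) f has_field_derivative (deriv ^^ Suc i) f x) (at x within cball 0 d)"
        using holomorphic_derivI[OF hol[of i] open_ball] sub by (auto intro: has_field_derivative_at_within)
    next
      show "cmod ((deriv ^^ Suc 2) f x) \<le> B" if "x \<in> cball 0 d" for x :: complex
        using B[OF that] by (simp add: numeral_3_eq_3)
    qed (use s assms in auto)
    then show "cmod (f s - (f 0 + deriv f 0 * s + deriv (deriv f) 0 * s\<^sup>2 / 2)) \<le> B / 2 * cmod s ^ 3"
      by (simp add: numeral_2_eq_2 numeral_3_eq_3)
  qed (use \<open>0 \<le> B\<close> in auto)
qed

section \<open>Uniform coefficient bounds\<close>

lemma gchoose_Suc_mult: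
  fixes a :: "'a :: field_char_0"
  shows "of_nat (Suc n) * (a gchoose Suc n) = (a - of_nat n) * (a gchoose n)"
  using gbinomial_mult_1[of a n] by (simp add: algebra_simps)

lemma half_gchoose_neq_0: "(1 / 2 :: complex) gchoose n \<noteq> 0"
proof (induction n)
  case (Suc n)
  have "(1 / 2 :: complex) \<noteq> of_nat n"
  proof
    assume "(1 / 2 :: complex) = of_nat n"
    then have "of_nat (2 * n) = (of_nat 1 :: complex)"
      unfolding of_nat_mult by (simp flip: \<open>1 / 2 = of_nat n\<close>)
    then have "2 * n = 1" by (simp only: of_nat_eq_iff)
    then show False by presburger
  qed
  then have "of_nat (Suc n) * ((1 / 2 :: complex) gchoose Suc n) \<noteq> 0"
    unfolding gchoose_Suc_mult using Suc by simp
  then show ?case by simp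
qed simp

text \<open>The moduli of these coefficients have ratios tending to 1, so after multiplication by
  \<open>b ^ n\<close> with \<open>b > 1\<close> they increase from some index on; the finitely many
  earlier terms are absorbed by \<open>hi / lo\<close>. This takes the place of the
  \<open>n powr (- 3/2)\<close> asymptotics.\<close>

lemma half_gchoose_growth:
  fixes b :: real
  assumes "b > 1"
  obtains C where "C > 0"
    "\<And>k n. k \<le> n \<Longrightarrow> cmod (1/2 gchoose k) * b ^ k \<le> C * (cmod (1/2 gchoose n) * b ^ n)"
proof -
  define c where "c n = cmod (1/2 gchoose n) * b ^ n" for n
  have c_pos: "c n > 0" for n
    using assms half_gchoose_neq_0 by (simp add: c_def)
  \<comment> \<open>The first condition is \<open>n + 1 \<le> b * (n - 1/2)\<close> solved for
    \<open>n\<close>; the second makes \<open>n - 1/2\<close> the modulus of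
    \<open>1/2 - n\<close>.\<close>
  obtain J :: nat where J: "real J \<ge> (1 + b / 2) / (b - 1)" "J \<ge> 1"
    using real_arch_simple[of "max 1 ((1 + b / 2) / (b - 1))"] by auto
  have c_Suc: "c n \<le> c (Suc n)" if "n \<ge> J" for n
  proof -
    have "real (Suc n) * cmod (1/2 gchoose Suc n) = cmod (1/2 - of_nat n) * cmod (1/2 gchoose n)"
      using arg_cong[OF gchoose_Suc_mult[of n "1/2 :: complex"], of cmod]
      by (simp only: norm_mult norm_of_nat)
    moreover have "cmod (1/2 - of_nat n) = real n - 1/2"
    proof -
      have "1/2 - of_nat n = complex_of_real (1/2 - real n)" by simp
      then show ?thesis using that J(2) by (simp only: norm_of_real)
    qed
    ultimately have "real (Suc n) * c (Suc n) = (b * (real n - 1/2)) * c n"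
      by (simp add: c_def mult_ac)
    moreover have "real (Suc n) \<le> b * (real n - 1/2)"
    proof -
      have "(1 + b / 2) / (b - 1) \<le> real n" using J(1) that by linarith
      then have "1 + b / 2 \<le> real n * (b - 1)" using assms by (simp add: pos_divide_le_eq)
      then show ?thesis by (simp add: algebra_simps)
    qed
    then have "real (Suc n) * c n \<le> (b * (real n - 1/2)) * c n"
      using c_pos[of n] by (intro mult_right_mono) auto
    ultimately have "real (Suc n) * c n \<le> real (Suc n) * c (Suc n)" by simp
    then show ?thesis by (simp only: mult_le_cancel_left_pos of_nat_0_less_iff zero_less_Suc)
  qed
  have c_mono: "c m \<le> c n" if "J \<le> m" "m \<le> n" for m n
    using that(2) by (induction n rule: dec_induct) (use c_Suc that(1) order_trans in \<open>force+\<close>)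
  define lo hi where "lo = Min (c ` {..J})" and "hi = Max (c ` {..J})"
  have lo: "lo > 0" "\<And>k. k \<le> J \<Longrightarrow> lo \<le> c k"
    unfolding lo_def using c_pos by (auto simp: Min_gr_iff)
  have hi: "\<And>k. k \<le> J \<Longrightarrow> c k \<le> hi"
    unfolding hi_def by auto
  have "lo \<le> hi" using lo(2)[of 0] hi[of 0] by simp
  show ?thesis
  proof (rule that[of "hi / lo"])
    fix k n :: nat assume "k \<le> n"
    have *: "c k \<le> hi / lo * c n" if "c k \<le> hi" "lo \<le> c n"
    proof -
      have "hi = hi / lo * lo" using lo(1) by simp
      also have "\<dots> \<le> hi / lo * c n"
        using lo(1) \<open>lo \<le> hi\<close> that(2) by (intro mult_left_mono) auto
      finally show ?thesis using that(1) by simp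
    qed
    have "c k \<le> hi / lo * c n"
    proof (cases "k \<le> J")
      case True
      have "lo \<le> c n"
        using lo(2)[of n] lo(2)[of J] c_mono[of J n] by (cases "n \<le> J") auto
      then show ?thesis using * hi[OF True] by simp
    next
      case False
      then have "c k \<le> 1 * c n" using c_mono[of k n] \<open>k \<le> n\<close> by simp
      also have "\<dots> \<le> hi / lo * c n"
        using c_pos[of n] lo(1) \<open>lo \<le> hi\<close> by (intro mult_right_mono) auto
      finally show ?thesis .
    qed
    then show "cmod (1/2 gchoose k) * b ^ k \<le> hi / lo * (cmod (1/2 gchoose n) * b ^ n)"
      by (simp add: c_def)
  qed (use lo(1) \<open>lo \<le> hi\<close> in auto)
qed

definition fps_sqrt_linear :: "'a :: field_char_0 \<Rightarrow> 'a fps" where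
  "fps_sqrt_linear c = fps_compose (fps_binomial (1/2)) (fps_const c * fps_X)"

lemma fps_sqrt_linear_square: "(fps_sqrt_linear c)\<^sup>2 = 1 + fps_const c * fps_X"
proof -
  have "fps_compose ((fps_binomial (1/2))\<^sup>2) (fps_const c * fps_X) = fps_compose (1 + fps_X) (fps_const c * fps_X)"
    by (simp add: fps_binomial_power fps_binomial_1)
  then show ?thesis
    by (simp add: fps_sqrt_linear_def fps_compose_power fps_compose_add_distrib)
qed

lemma fps_sqrt_linear_nth: "fps_nth (fps_sqrt_linear c) n = c ^ n * (1/2 gchoose n)"
  by (simp add: fps_sqrt_linear_def)

text \<open>Catalan numbers, read off from the discriminant at \<open>v = 1\<close>, which is
  \<open>1 - 4 * fps_X\<close>. The unusual form exhibits the same factor as the bound in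
  \<open>cut_size_gf_bound\<close>, so that it cancels later.\<close>

lemma card_plane_trees:
  assumes "n \<ge> 1"
  shows "2 * real (card (plane_trees n)) = 4 ^ n * cmod (1/2 gchoose n)"
proof -
  define G where "G = cut_size_gf 1 (1 :: complex)"
  have "(1 - 2 * G)\<^sup>2 = 1 - 4 * fps_X"
    using cut_size_gf_eq[of 1 "1 :: complex"] by (simp add: G_def)
  also have "\<dots> = (fps_sqrt_linear (-4))\<^sup>2"
    by (simp add: fps_sqrt_linear_square numeral_fps_const flip: fps_const_neg)
  finally have "1 - 2 * G = fps_sqrt_linear (-4) \<or> 1 - 2 * G = - fps_sqrt_linear (-4)"
    by (simp only: power2_eq_iff)
  then have "cmod (fps_nth (1 - 2 * G) n) = cmod (fps_nth (fps_sqrt_linear (-4)) n)"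
    by (elim disjE) (simp_all only: fps_neg_nth norm_minus_cancel)
  moreover have "fps_nth (1 - 2 * G) n = - of_real (2 * real (card (plane_trees n)))"
    using assms by (simp add: G_def cut_size_gf_def tree_gf_def numeral_fps_const)
  ultimately show ?thesis
    by (simp add: fps_sqrt_linear_nth norm_mult norm_power del: of_real_mult)
qed

section \<open>From the discriminant to its square root and the coefficients\<close>

lemma fps_nth_bound:
  assumes "f has_fps_expansion F" "f holomorphic_on ball 0 R" "0 < x" "x < R"
    and "\<And>z. z \<in> ball 0 R \<Longrightarrow> cmod (f z) \<le> B"
  shows "cmod (fps_nth F n) \<le> B / x ^ n"
proof -
  have "cmod ((deriv ^^ n) f 0) \<le> fact n * B / x ^ n"
  proof (rule Cauchy_inequality)
    show "f holomorphic_on ball 0 x"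
      using assms(2) by (rule holomorphic_on_subset) (use assms in auto)
    show "continuous_on (cball 0 x) f"
      by (rule continuous_on_subset[OF holomorphic_on_imp_continuous_on[OF assms(2)]]) (use assms in auto)
  qed (use assms in auto)
  then show ?thesis
    unfolding fps_nth_fps_expansion[OF assms(1)] by (simp add: norm_divide field_simps)
qed

text \<open>With \<open>w = 1 - v\<close> the discriminant is \<open>1 - 4 * z + w * E z\<close>.
  Subtracting its value 0 at \<open>\<rho>\<close> gives \<open>(\<rho> - z) * (4 - w * g z)\<close>
  with the difference quotient \<open>g\<close> of \<open>E\<close>. The smallness of
  \<open>w\<close> makes \<open>cmod (w * g z) \<le> 2\<close>, so the second factor lies in the
  right half-plane and has a holomorphic square root. All bounds are independent of \<open>v\<close>
  and \<open>\<rho>\<close>.\<close>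

lemma cut_size_discriminant_factorization:
  fixes v \<rho> :: complex
  assumes l: "low_tree_fun r holomorphic_on ball 0 R"
      "\<And>z. z \<in> ball 0 R \<Longrightarrow> cmod (low_tree_fun r z) \<le> 1"
    and l': "\<And>z. z \<in> ball 0 R \<Longrightarrow> cmod (deriv (low_tree_fun r) z) \<le> B"
    and v: "cmod (1 - v) \<le> 1" "cmod (1 - v) * (4 + 4 * B) \<le> 2"
    and \<rho>: "\<rho> \<in> ball 0 R" "(1 - (1 - v) * low_tree_fun r \<rho>)\<^sup>2 = 4 * v * \<rho>"
  obtains h where "h holomorphic_on ball 0 R" "\<And>z. z \<in> ball 0 R \<Longrightarrow> cmod (h z) \<le> 3"
    "\<And>z. z \<in> ball 0 R \<Longrightarrow> (h z)\<^sup>2 * (\<rho> - z) = (1 - (1 - v) * low_tree_fun r z)\<^sup>2 - 4 * v * z"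
proof -
  define l where "l = low_tree_fun r"
  define w where "w = 1 - v"
  define E where "E z = 4 * z - 2 * l z + w * (l z)\<^sup>2" for z
  define E' where "E' z = 4 - 2 * deriv l z + 2 * w * l z * deriv l z" for z
  define g where "g z = (if z = \<rho> then deriv E \<rho> else (E z - E \<rho>) / (z - \<rho>))" for z
  have disc: "(1 - (1 - v) * low_tree_fun r z)\<^sup>2 - 4 * v * z = 1 - 4 * z + w * E z" for z
    by (simp add: w_def E_def l_def power2_eq_square algebra_simps)
  have hol_l: "l holomorphic_on ball 0 R" using l by (simp add: l_def)
  have hol_E: "E holomorphic_on ball 0 R"
    unfolding E_def by (intro holomorphic_intros hol_l)
  have DE: "(E has_field_derivative E' z) (at z)" if "z \<in> ball 0 R" for z
    unfolding E_def E'_def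
    by (rule derivative_eq_intros holomorphic_derivI[OF hol_l open_ball that] refl)+ (simp add: algebra_simps)
  have E'_le: "cmod (E' z) \<le> 4 + 4 * B" if z: "z \<in> ball 0 R" for z
  proof -
    have B: "cmod (deriv l z) \<le> B" using l'[OF z] by (simp add: l_def)
    have lz: "cmod (l z) \<le> 1" using l(2)[OF z] by (simp add: l_def)
    have "cmod (w * l z) \<le> 1 * 1"
      unfolding norm_mult using v lz by (intro mult_mono) (auto simp: w_def)
    then have "cmod (w * l z * deriv l z) \<le> 1 * B"
      unfolding norm_mult[of "w * l z"] using B by (intro mult_mono) auto
    moreover have "cmod (E' z) \<le> cmod (4 - 2 * deriv l z) + cmod (2 * w * l z * deriv l z)"
      unfolding E'_def by (rule norm_triangle_ineq)
    moreover have "cmod (4 - 2 * deriv l z) \<le> cmod 4 + cmod (2 * deriv l z)"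
      by (rule norm_triangle_ineq4)
    ultimately show ?thesis using B by (simp add: norm_mult mult.assoc)
  qed
  have g_le: "cmod (g z) \<le> 4 + 4 * B" if z: "z \<in> ball 0 R" for z
  proof (cases "z = \<rho>")
    case True
    then show ?thesis using E'_le[OF \<rho>(1)] DERIV_imp_deriv[OF DE[OF \<rho>(1)]] by (simp add: g_def)
  next
    case False
    have "cmod (E z - E \<rho>) \<le> (4 + 4 * B) * cmod (z - \<rho>)"
      by (rule field_differentiable_bound[OF convex_ball[of 0 R]])
        (use DE E'_le z \<rho>(1) in \<open>auto intro: has_field_derivative_at_within\<close>)
    then show ?thesis using False by (simp add: g_def norm_divide pos_divide_le_eq)
  qed
  \<comment> \<open>The singularity of the difference quotient at \<open>\<rho>\<close> is
    removable.\<close>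
  have hol_g: "g holomorphic_on ball 0 R"
    unfolding g_def by (rule pole_lemma_open[OF hol_E open_ball])
  define K where "K z = 4 - w * g z" for z
  have wg: "cmod (w * g z) \<le> 2" if "z \<in> ball 0 R" for z
    using order_trans[OF mult_left_mono[OF g_le[OF that], of "cmod w"] v(2)[folded w_def]]
    by (simp add: norm_mult)
  have K_nonpos: "K z \<notin> \<real>\<^sub>\<le>\<^sub>0" if "z \<in> ball 0 R" for z
    using wg[OF that] complex_Re_le_cmod[of "w * g z"] by (simp add: K_def complex_nonpos_Reals_iff)
  have K_le: "cmod (K z) \<le> 9" if "z \<in> ball 0 R" for z
    using wg[OF that] norm_triangle_ineq4[of 4 "w * g z"] by (simp add: K_def)
  show ?thesis
  proof (rule that[of "\<lambda>z. csqrt (K z)"])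
    have "K holomorphic_on ball 0 R"
      unfolding K_def by (intro holomorphic_intros hol_g)
    then show "(\<lambda>z. csqrt (K z)) holomorphic_on ball 0 R"
      by (intro holomorphic_intros K_nonpos)
    fix z :: complex assume z: "z \<in> ball 0 R"
    have "(cmod (csqrt (K z)))\<^sup>2 = cmod (K z)"
      by (simp flip: norm_power)
    then have "(cmod (csqrt (K z)))\<^sup>2 \<le> 3\<^sup>2"
      using K_le[OF z] by simp
    then show "cmod (csqrt (K z)) \<le> 3"
      by (rule power2_le_imp_le) simp
    have "1 - 4 * \<rho> + w * E \<rho> = 0"
      using disc[of \<rho>] \<rho>(2) by simp
    moreover have "g z * (z - \<rho>) = E z - E \<rho>"
      by (simp add: g_def)
    moreover have "K z * (\<rho> - z) = 4 * (\<rho> - z) + w * (g z * (z - \<rho>))"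
      by (simp add: K_def algebra_simps)
    ultimately have K: "1 - 4 * \<rho> + w * E \<rho> = 0" "K z * (\<rho> - z) = 4 * (\<rho> - z) + w * (E z - E \<rho>)"
      by simp_all
    have "4 * (\<rho> - z) + w * (E z - E \<rho>) = 1 - 4 * z + w * E z - (1 - 4 * \<rho> + w * E \<rho>)"
      by (simp add: algebra_simps)
    then have "K z * (\<rho> - z) = 1 - 4 * z + w * E z"
      using K by simp
    then show "(csqrt (K z))\<^sup>2 * (\<rho> - z) = (1 - (1 - v) * low_tree_fun r z)\<^sup>2 - 4 * v * z"
      by (simp add: disc)
  qed
qed

text \<open>Up to sign, the root of the discriminant is \<open>h z * csqrt \<rho>\<close> times the
  binomial series of \<open>sqrt (1 - z / \<rho>)\<close>. The coefficients of \<open>h\<close>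
  decay on a larger disc, so in the convolution the k-th term, scaled by
  \<open>cmod \<rho> ^ n\<close>, is of order \<open>q ^ k * a (n - k)\<close> with
  \<open>q < 1\<close>; the sum is then comparable with \<open>a n\<close>.\<close>

lemma cut_size_gf_bound:
  assumes "r \<ge> 1"
  obtains R C \<eta> where "R > 1/4" "C > 0" "\<eta> > 0" "low_tree_fun r holomorphic_on ball 0 R"
    "\<And>v \<rho> n. \<lbrakk>cmod (1 - v) \<le> \<eta>; cmod \<rho> < R; (1 - (1 - v) * low_tree_fun r \<rho>)\<^sup>2 = 4 * v * \<rho>; n \<ge> 1\<rbrakk>
      \<Longrightarrow> cmod (fps_nth (cut_size_gf r v) n) * cmod \<rho> ^ n \<le> C * cmod (1/2 gchoose n)"
proof -
  define l where "l = low_tree_fun r"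
  obtain R0 where R0: "R0 > 1/4" "l holomorphic_on ball 0 R0" "\<And>z. z \<in> ball 0 R0 \<Longrightarrow> cmod (l z) \<le> 1"
    using low_tree_fun_bound[of r 1] unfolding l_def by (auto simp: field_simps)
  define d where "d = min (R0 - 1/4) 1 / 4"
  have d: "d > 0" "d \<le> 1/4" "1/4 + 4 * d \<le> R0"
    using R0(1) by (auto simp: d_def)
  \<comment> \<open>Nested radii: \<open>\<rho>\<close> lies within \<open>R1\<close>, Cauchy's
    estimate is taken at \<open>R2\<close>, \<open>h\<close> lives on the disc of radius
    \<open>R3\<close>, and \<open>R3 < R0\<close> gives a bound for the derivative of
    \<open>l\<close> by compactness.\<close>
  define R1 R2 R3 where "R1 = 1/4 + d" and "R2 = 1/4 + 2 * d" and "R3 = 1/4 + 3 * d"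
  have R: "1/4 < R1" "R1 < R2" "R2 < R3" "R3 < R0" "R1 \<le> 1"
    using d by (auto simp: R1_def R2_def R3_def)
  have hol: "l holomorphic_on ball 0 R3" and hol_1: "l holomorphic_on ball 0 R1"
    using R0(2) R by (auto intro: holomorphic_on_subset)
  have l_le: "cmod (l z) \<le> 1" if "z \<in> ball 0 R3" for z
    using R0(3)[of z] that R by auto
  obtain B where B: "\<And>z. z \<in> ball 0 R3 \<Longrightarrow> cmod (deriv l z) \<le> B"
  proof -
    have "continuous_on (cball 0 R3) (deriv l)"
      by (rule continuous_on_subset[OF holomorphic_on_imp_continuous_on[OF holomorphic_deriv[OF R0(2) open_ball]]])
        (use R in auto)
    then have "bounded (deriv l ` cball 0 R3)"
      by (intro compact_imp_bounded compact_continuous_image) auto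
    then obtain B where "\<forall>z\<in>cball 0 R3. cmod (deriv l z) \<le> B"
      unfolding bounded_iff by blast
    then show ?thesis by (intro that[of B]) auto
  qed
  have B0: "B \<ge> 0"
    using order_trans[OF norm_ge_zero B[of 0]] R by simp
  \<comment> \<open>What the factorization of the discriminant requires of
    \<open>cmod (1 - v)\<close>.\<close>
  define \<eta> where "\<eta> = min 1 (2 / (4 + 4 * B))"
  have \<eta>: "\<eta> > 0" "\<eta> \<le> 1" "\<eta> * (4 + 4 * B) \<le> 2"
  proof -
    show "\<eta> > 0" "\<eta> \<le> 1" using B0 by (auto simp: \<eta>_def)
    have "\<eta> * (4 + 4 * B) \<le> 2 / (4 + 4 * B) * (4 + 4 * B)"
      using B0 by (intro mult_right_mono) (auto simp: \<eta>_def)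
    also have "\<dots> = 2"
    proof -
      have "2 / x * x = 2" if "x \<noteq> 0" for x :: real using that by simp
      then show ?thesis using B0 by (metis add_pos_nonneg less_irrefl mult_nonneg_nonneg zero_le_numeral zero_less_numeral)
    qed
    finally show "\<eta> * (4 + 4 * B) \<le> 2" .
  qed
  define q where "q = R1 / R2"
  have q: "0 < q" "q < 1" using R by (auto simp: q_def)
  \<comment> \<open>Between 1 and \<open>1 / q\<close>: replacing \<open>a (n - k)\<close> by
    \<open>a n\<close> costs \<open>b ^ k\<close>, and \<open>b * q = sqrt q\<close> still gives a
    convergent geometric series.\<close>
  define b where "b = 1 / sqrt q"
  have b: "b > 1" "b * q < 1" "b * q > 0"
  proof -
    show "b > 1" using q by (simp add: b_def)
    have "b * q = sqrt q" using q by (simp add: b_def real_div_sqrt)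
    then show "b * q < 1" "b * q > 0" using q by auto
  qed
  define a where "a n = cmod (1/2 gchoose n)" for n
  obtain D where D: "D > 0" "\<And>k n. k \<le> n \<Longrightarrow> a k * b ^ k \<le> D * (a n * b ^ n)"
    using half_gchoose_growth[OF b(1)] unfolding a_def by metis
  have a_le: "a (n - k) \<le> D * a n * b ^ k" if "k \<le> n" for n k
  proof -
    have "b ^ n = b ^ (n - k) * b ^ k" using that by (simp flip: power_add)
    then have "b ^ (n - k) * a (n - k) \<le> b ^ (n - k) * (D * a n * b ^ k)"
      using D(2)[of "n - k" n] by (simp add: mult_ac)
    then show ?thesis using b(1) by simp
  qed
  define S where "S = 1 / (1 - b * q)"
  have "S > 0" using b by (simp add: S_def)
  \<comment> \<open>\<open>3 * D * S\<close> comes from the convolution with the coefficients of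
    \<open>h\<close>, \<open>D\<close> from the term \<open>w * L\<close>, and the halving from
    \<open>2 * G\<close>.\<close>
  define C where "C = (3 * D * S + D) / 2"
  show ?thesis
  proof (rule that[of R1 C \<eta>])
    show "C > 0" using D(1) \<open>S > 0\<close> by (simp add: C_def add_pos_pos)
    fix v \<rho> :: complex and n :: nat
    assume v: "cmod (1 - v) \<le> \<eta>" and \<rho>: "cmod \<rho> < R1"
      and sing: "(1 - (1 - v) * low_tree_fun r \<rho>)\<^sup>2 = 4 * v * \<rho>" and n: "n \<ge> 1"
    define w where "w = 1 - v"
    have "cmod w * (4 + 4 * B) \<le> \<eta> * (4 + 4 * B)"
      using v B0 unfolding w_def by (intro mult_right_mono) auto
    then have w: "cmod w \<le> 1" "cmod w * (4 + 4 * B) \<le> 2"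
      using v \<eta> unfolding w_def by linarith+
    have "\<rho> \<noteq> 0"
    proof
      assume "\<rho> = 0"
      moreover have "low_tree_fun r 0 = 0" using assms by (cases r) auto
      ultimately show False using sing by simp
    qed
    obtain h where h: "h holomorphic_on ball 0 R3" "\<And>z. z \<in> ball 0 R3 \<Longrightarrow> cmod (h z) \<le> 3"
        "\<And>z. z \<in> ball 0 R3 \<Longrightarrow> (h z)\<^sup>2 * (\<rho> - z) = (1 - w * l z)\<^sup>2 - 4 * v * z"
      using cut_size_discriminant_factorization[of r R3 B v \<rho>] hol l_le B w \<rho> R sing
      unfolding w_def l_def by auto
    define H where "H = fps_expansion h 0"
    define L where "L = (low_tree_gf r :: complex fps)"
    define G where "G = cut_size_gf r v"
    have exp_h: "h has_fps_expansion H"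
      unfolding H_def using h(1) R by (intro has_fps_expansion_fps_expansion[of "ball 0 R3"]) auto
    have exp_l: "l has_fps_expansion L"
      unfolding l_def L_def by (rule low_tree_fun_has_fps_expansion)
    have H_le: "cmod (fps_nth H k) \<le> 3 / R2 ^ k" for k
      by (rule fps_nth_bound[OF exp_h h(1)]) (use h R in auto)
    have L_le: "cmod (fps_nth L k) \<le> 1 / R2 ^ k" for k
      by (rule fps_nth_bound[OF exp_l hol]) (use l_le R in auto)
    have "H\<^sup>2 * (fps_const \<rho> - fps_X) = (1 - fps_const w * L)\<^sup>2 - 4 * fps_const v * fps_X"
    proof (rule fps_expansion_unique_complex)
      show "(\<lambda>z. (h z)\<^sup>2 * (\<rho> - z)) has_fps_expansion H\<^sup>2 * (fps_const \<rho> - fps_X)"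
        by (intro fps_expansion_intros exp_h)
      have "eventually (\<lambda>z. z \<in> ball 0 R3) (nhds (0 :: complex))"
        using R by (intro eventually_nhds_in_open) auto
      then have "eventually (\<lambda>z. (1 - w * l z)\<^sup>2 - 4 * v * z = (h z)\<^sup>2 * (\<rho> - z)) (nhds 0)"
        by eventually_elim (simp add: h(3))
      moreover have "(\<lambda>z. (1 - w * l z)\<^sup>2 - 4 * v * z)
          has_fps_expansion (1 - fps_const w * L)\<^sup>2 - 4 * fps_const v * fps_X"
        by (intro fps_expansion_intros exp_l)
      ultimately show "(\<lambda>z. (h z)\<^sup>2 * (\<rho> - z)) has_fps_expansion (1 - fps_const w * L)\<^sup>2 - 4 * fps_const v * fps_X"
        by (simp cong: has_fps_expansion_cong)
    qed
    moreover have "fps_const \<rho> - fps_X = fps_const \<rho> * (1 + fps_const (- 1 / \<rho>) * fps_X)"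
      using \<open>\<rho> \<noteq> 0\<close> by (simp add: distrib_left mult.assoc[symmetric] fps_const_mult[symmetric] del: fps_const_mult)
    then have "fps_const \<rho> - fps_X = (fps_const (csqrt \<rho>) * fps_sqrt_linear (- 1 / \<rho>))\<^sup>2"
      by (simp add: power_mult_distrib fps_sqrt_linear_square fps_const_power)
    ultimately have "(1 + fps_const w * L - 2 * G)\<^sup>2 = (H * (fps_const (csqrt \<rho>) * fps_sqrt_linear (- 1 / \<rho>)))\<^sup>2"
      unfolding G_def L_def w_def by (simp only: cut_size_gf_eq[OF assms] power_mult_distrib)
    then have "1 + fps_const w * L - 2 * G = H * (fps_const (csqrt \<rho>) * fps_sqrt_linear (- 1 / \<rho>)) \<or>
        1 + fps_const w * L - 2 * G = - (H * (fps_const (csqrt \<rho>) * fps_sqrt_linear (- 1 / \<rho>)))"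
      by (simp only: power2_eq_iff)
    \<comment> \<open>The undetermined sign of the square root disappears in the modulus.\<close>
    then have "cmod (fps_nth (1 + fps_const w * L - 2 * G) n)
        = cmod (fps_nth (H * (fps_const (csqrt \<rho>) * fps_sqrt_linear (- 1 / \<rho>))) n)"
      by (elim disjE) (simp_all only: fps_neg_nth norm_minus_cancel)
    also have "fps_nth (1 + fps_const w * L - 2 * G) n = w * fps_nth L n - 2 * fps_nth G n"
      using n by (simp add: numeral_fps_const)
    also have "fps_nth (H * (fps_const (csqrt \<rho>) * fps_sqrt_linear (- 1 / \<rho>))) n
        = (\<Sum>k\<le>n. fps_nth H k * (csqrt \<rho> * ((- 1 / \<rho>) ^ (n - k) * (1/2 gchoose (n - k)))))"
      unfolding fps_mult_nth[of H] by (simp add: fps_sqrt_linear_nth atLeast0AtMost)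
    finally have eq: "cmod (w * fps_nth L n - 2 * fps_nth G n)
        = cmod (\<Sum>k\<le>n. fps_nth H k * (csqrt \<rho> * ((- 1 / \<rho>) ^ (n - k) * (1/2 gchoose (n - k)))))" .
    have \<rho>_pow: "(cmod \<rho> / R2) ^ k \<le> q ^ k" for k
    proof (rule power_mono)
      show "cmod \<rho> / R2 \<le> q" unfolding q_def using \<rho> R by (intro divide_right_mono) auto
    qed (use R in auto)
    have csqrt_le: "cmod (csqrt \<rho>) \<le> 1"
    proof (rule power2_le_imp_le)
      have "(cmod (csqrt \<rho>))\<^sup>2 = cmod ((csqrt \<rho>)\<^sup>2)"
        by (simp only: norm_power)
      also have "\<dots> = cmod \<rho>" by (simp only: power2_csqrt)
      finally show "(cmod (csqrt \<rho>))\<^sup>2 \<le> 1\<^sup>2" using \<rho> R(5) by simp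
    qed simp
    have "cmod (\<Sum>k\<le>n. fps_nth H k * (csqrt \<rho> * ((- 1 / \<rho>) ^ (n - k) * (1/2 gchoose (n - k))))) * cmod \<rho> ^ n
        \<le> (\<Sum>k\<le>n. cmod (fps_nth H k * (csqrt \<rho> * ((- 1 / \<rho>) ^ (n - k) * (1/2 gchoose (n - k))))) * cmod \<rho> ^ n)"
    proof -
      have *: "cmod (\<Sum>k\<le>n. f k) * x \<le> (\<Sum>k\<le>n. cmod (f k) * x)" if "x \<ge> 0" for f and x :: real
        using mult_right_mono[OF norm_sum[of f "{..n}"] that] by (simp only: sum_distrib_right)
      show ?thesis by (rule *) simp
    qed
    also have "\<dots> \<le> (\<Sum>k\<le>n. 3 * D * a n * (b * q) ^ k)"
    proof (rule sum_mono)
      fix k assume "k \<in> {..n}"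
      then have k: "k \<le> n" by simp
      have "cmod \<rho> ^ n = cmod \<rho> ^ (n - k) * cmod \<rho> ^ k" using k by (simp flip: power_add)
      then have "cmod (fps_nth H k * (csqrt \<rho> * ((- 1 / \<rho>) ^ (n - k) * (1/2 gchoose (n - k))))) * cmod \<rho> ^ n
          = cmod (fps_nth H k) * cmod \<rho> ^ k * cmod (csqrt \<rho>) * a (n - k)"
        using \<open>\<rho> \<noteq> 0\<close> by (simp add: norm_mult norm_power norm_divide power_divide a_def)
      also have "\<dots> \<le> 3 / R2 ^ k * cmod \<rho> ^ k * 1 * (D * a n * b ^ k)"
        using R D(1) b(1) by (intro mult_mono H_le csqrt_le a_le k) (auto simp: a_def)
      also have "\<dots> = 3 * (cmod \<rho> / R2) ^ k * (D * a n * b ^ k)"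
        by (simp add: power_divide)
      also have "\<dots> \<le> 3 * q ^ k * (D * a n * b ^ k)"
        using D(1) b(1) \<rho>_pow by (intro mult_right_mono mult_left_mono) (auto simp: a_def)
      finally show "cmod (fps_nth H k * (csqrt \<rho> * ((- 1 / \<rho>) ^ (n - k) * (1/2 gchoose (n - k))))) * cmod \<rho> ^ n
          \<le> 3 * D * a n * (b * q) ^ k"
        by (simp add: power_mult_distrib mult_ac)
    qed
    also have "\<dots> = 3 * D * a n * (\<Sum>k\<le>n. (b * q) ^ k)"
      by (simp add: sum_distrib_left)
    finally have 0: "cmod (w * fps_nth L n - 2 * fps_nth G n) * cmod \<rho> ^ n \<le> 3 * D * a n * (\<Sum>k\<le>n. (b * q) ^ k)"
      unfolding eq .
    have "(\<Sum>k\<le>n. (b * q) ^ k) \<le> S"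
    proof -
      have "(\<Sum>k<Suc n. (b * q) ^ k) \<le> (\<Sum>k. (b * q) ^ k)"
        using b by (intro sum_le_suminf summable_geometric) auto
      then show ?thesis using b by (simp add: suminf_geometric lessThan_Suc_atMost S_def)
    qed
    then have "3 * D * a n * (\<Sum>k\<le>n. (b * q) ^ k) \<le> 3 * D * a n * S"
      using D(1) by (intro mult_left_mono) (auto simp: a_def)
    with 0 have 1: "cmod (w * fps_nth L n - 2 * fps_nth G n) * cmod \<rho> ^ n \<le> 3 * D * a n * S"
      by (rule order_trans)
    \<comment> \<open>This term is exponentially small; it is brought to the form
      \<open>D * a n\<close> by \<open>1 = a 0 * b ^ 0 \<le> D * (a n * b ^ n)\<close>.\<close>
    have "cmod (w * fps_nth L n) * cmod \<rho> ^ n \<le> 1 * (1 / R2 ^ n) * cmod \<rho> ^ n"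
      unfolding norm_mult using w L_le R by (intro mult_mono) auto
    also have "\<dots> = (cmod \<rho> / R2) ^ n" by (simp add: power_divide)
    also have "\<dots> \<le> q ^ n * 1" using \<rho>_pow by simp
    also have "\<dots> \<le> q ^ n * (D * (a n * b ^ n))"
      using D(2)[of 0 n] q by (intro mult_left_mono) (auto simp: a_def)
    also have "\<dots> = D * a n * (b * q) ^ n" by (simp add: power_mult_distrib mult_ac)
    also have "\<dots> \<le> D * a n * 1"
      using D(1) b by (intro mult_left_mono power_le_one) (auto simp: a_def)
    finally have 2: "cmod (w * fps_nth L n) * cmod \<rho> ^ n \<le> D * a n" by simp
    have "2 * cmod (fps_nth G n) = cmod (w * fps_nth L n - (w * fps_nth L n - 2 * fps_nth G n))"
      by (simp add: norm_mult)
    also have "\<dots> \<le> cmod (w * fps_nth L n) + cmod (w * fps_nth L n - 2 * fps_nth G n)"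
      by (rule norm_triangle_ineq4)
    finally have "2 * cmod (fps_nth G n) * cmod \<rho> ^ n
        \<le> (cmod (w * fps_nth L n) + cmod (w * fps_nth L n - 2 * fps_nth G n)) * cmod \<rho> ^ n"
      by (intro mult_right_mono) auto
    also have "\<dots> \<le> D * a n + 3 * D * a n * S"
      unfolding distrib_right by (rule add_mono[OF 2 1])
    also have "\<dots> = 2 * (C * a n)"
      by (simp add: C_def algebra_simps)
    finally show "cmod (fps_nth (cut_size_gf r v) n) * cmod \<rho> ^ n \<le> C * cmod (1/2 gchoose n)"
      by (simp add: G_def a_def)
  qed (use R \<eta> hol_1 in \<open>auto simp: l_def\<close>)
qed

section \<open>Esseen's smoothing inequality\<close>

text \<open>The Fejer kernel: \<open>(1 - cos x) / x\<^sup>2\<close> is half the square of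
  \<open>sin (x / 2) / (x / 2)\<close>, and its Fourier transform has compact support. The value 0
  at \<open>x = 0\<close> affects a null set only.\<close>

definition fejer :: "real \<Rightarrow> real" where
  "fejer x = (1 - cos x) / x\<^sup>2"

lemma fejer_nonneg: "fejer x \<ge> 0"
  by (simp add: fejer_def)

lemma fejer_le: "fejer x \<le> 4 / (1 + x\<^sup>2)"
proof (cases "x = 0")
  case False
  show ?thesis
  proof (cases "\<bar>x\<bar> \<le> 1")
    case True
    have "1 - cos x \<le> x\<^sup>2 / 2"
    proof -
      have "cos x = 1 - 2 * (sin (x / 2))\<^sup>2"
        using cos_double_sin[of "x / 2"] by simp
      moreover have "(sin (x / 2))\<^sup>2 \<le> (x / 2)\<^sup>2"
        using abs_sin_x_le_abs_x[of "x / 2"] by (simp only: abs_le_square_iff)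
      ultimately show ?thesis by (simp add: power_divide)
    qed
    then have "fejer x \<le> 1 / 2"
      using False by (simp add: fejer_def field_simps)
    also have "1 / 2 \<le> 4 / (1 + x\<^sup>2)"
      using abs_square_le_1[of x] True by (simp add: field_simps add_pos_nonneg)
    finally show ?thesis .
  next
    case 1: False
    then have "1 \<le> x\<^sup>2"
      using abs_square_less_1[of x] by auto
    moreover have "fejer x \<le> 2 / x\<^sup>2"
      unfolding fejer_def using cos_ge_minus_one[of x] by (intro divide_right_mono) auto
    moreover have "2 / x\<^sup>2 \<le> 4 / (1 + x\<^sup>2)"
      using \<open>1 \<le> x\<^sup>2\<close> frac_le[of "4" 4 "1 + x\<^sup>2" "2 * x\<^sup>2"] by simp
    ultimately show ?thesis by linarith
  qed
qed (simp add: fejer_def)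

lemma borel_measurable_fejer [measurable]: "fejer \<in> borel_measurable borel"
  unfolding fejer_def by measurable

lemma integrable_4_div_1_plus_square: "integrable lborel (\<lambda>x::real. 4 / (1 + x\<^sup>2))"
proof -
  have "integrable lborel (\<lambda>x::real. 4 * inverse (1 + x\<^sup>2))"
    using integrable_inverse_1_plus_square by (intro integrable_mult_right) (simp add: set_integrable_def)
  then show ?thesis by (simp add: divide_inverse)
qed

lemma integrable_fejer: "integrable lborel fejer"
  by (rule Bochner_Integration.integrable_bound[OF integrable_4_div_1_plus_square])
    (auto simp: fejer_nonneg intro!: AE_I2 order.trans[OF fejer_le])

lemma integral_fejer_pos: "integral\<^sup>L lborel fejer > 0"
proof -
  have "integral\<^sup>L lborel fejer \<noteq> 0"
  proof
    assume "integral\<^sup>L lborel fejer = 0"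
    then have "AE x in lborel. fejer x = 0"
      using integral_nonneg_eq_0_iff_AE[OF integrable_fejer] fejer_nonneg by simp
    moreover have "fejer x > 0" if "x \<in> {1..2}" for x
    proof -
      have "cos x < cos 0"
        using that pi_ge_two by (intro cos_monotone_0_pi) auto
      then show ?thesis using that by (simp add: fejer_def)
    qed
    ultimately have "AE x in lborel. x \<notin> {1..2::real}"
      by (auto elim!: eventually_mono) (metis less_irrefl)
    then have "emeasure lborel {1..2::real} = 0"
      by (subst (asm) AE_iff_measurable[of "{1..2}"]) auto
    then show False by simp
  qed
  then show ?thesis
    using integral_nonneg_AE[of fejer lborel] fejer_nonneg by (simp add: less_le)
qed

text \<open>
  By scaling, the Fourier transform of the kernel is determined up to the constant
  \<open>integral\<^sup>L lborel fejer\<close>, whose value \<open>\<pi>\<close> is irrelevant.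
\<close>

lemma cos_diff_quotient_integral:
  fixes a :: real
  shows "has_bochner_integral lborel (\<lambda>x. (1 - cos (a * x)) / x\<^sup>2) (\<bar>a\<bar> * integral\<^sup>L lborel fejer)"
proof (cases "a = 0")
  case False
  have "has_bochner_integral lborel (\<lambda>x. fejer (0 + a * x)) (integral\<^sup>L lborel fejer /\<^sub>R \<bar>a\<bar>)"
    using has_bochner_integral_integrable[OF integrable_fejer] False
    by (subst (asm) lborel_has_bochner_integral_real_affine_iff[of a _ _ 0]) auto
  then have "has_bochner_integral lborel (\<lambda>x. a\<^sup>2 * fejer (0 + a * x)) (a\<^sup>2 * (integral\<^sup>L lborel fejer /\<^sub>R \<bar>a\<bar>))"
    by (rule has_bochner_integral_mult_right) 
  moreover have "a\<^sup>2 * fejer (0 + a * x) = (1 - cos (a * x)) / x\<^sup>2" for x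
    using False by (simp add: fejer_def power_mult_distrib)
  moreover have "a\<^sup>2 * (integral\<^sup>L lborel fejer /\<^sub>R \<bar>a\<bar>) = \<bar>a\<bar> * integral\<^sup>L lborel fejer"
    using False by (simp add: power2_eq_square field_simps abs_if)
  ultimately show ?thesis by (simp only:)
qed (simp add: has_bochner_integral_zero)

definition fejer_distribution :: "real measure" where
  "fejer_distribution = density lborel (\<lambda>x. ennreal (fejer x / integral\<^sup>L lborel fejer))"

lemma real_distribution_fejer: "real_distribution fejer_distribution"
proof -
  have "(\<integral>\<^sup>+x. ennreal (fejer x / integral\<^sup>L lborel fejer) \<partial>lborel)
      = ennreal (\<integral>x. fejer x / integral\<^sup>L lborel fejer \<partial>lborel)"
    using integral_fejer_pos
    by (intro nn_integral_eq_integral integrable_divide integrable_fejer) (auto simp: fejer_nonneg)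
  also have "\<dots> = 1"
    using integral_fejer_pos by simp
  finally have "prob_space fejer_distribution"
    unfolding fejer_distribution_def by (intro prob_spaceI) (simp add: emeasure_density)
  then show ?thesis
    unfolding real_distribution_def real_distribution_axioms_def
    by (auto simp: fejer_distribution_def)
qed

lemma emeasure_fejer_singleton: "emeasure fejer_distribution {a} = 0"
proof -
  have "AE x in lborel. x \<notin> {a}"
    by (rule AE_not_in) (rule finite_imp_null_set_lborel, simp)
  then show ?thesis
    unfolding fejer_distribution_def
    by (subst emeasure_density) (auto simp: nn_integral_0_iff_AE elim!: eventually_mono split: split_indicator)
qed

text \<open>By the addition formulas \<open>(1 - cos x) * cos (t * x)\<close> is a combination of
  \<open>1 - cos (a * x)\<close> for \<open>a = 1 + t, 1 - t, t\<close>. Integration turns it into a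
  multiple of \<open>\<bar>1 + t\<bar> / 2 + \<bar>1 - t\<bar> / 2 - \<bar>t\<bar>\<close>, which
  vanishes for \<open>\<bar>t\<bar> \<ge> 1\<close>.\<close>

lemma char_fejer_eq_0:
  assumes "\<bar>t\<bar> \<ge> 1"
  shows "char fejer_distribution t = 0"
proof -
  define c where "c = integral\<^sup>L lborel fejer"
  have c: "c > 0" using integral_fejer_pos by (simp add: c_def)
  have int_cos: "has_bochner_integral lborel (\<lambda>x. fejer x * cos (t * x)) 0"
  proof -
    have "has_bochner_integral lborel
        (\<lambda>x. ((1 - cos ((1 + t) * x)) / x\<^sup>2 / 2 + (1 - cos ((1 - t) * x)) / x\<^sup>2 / 2) - (1 - cos (t * x)) / x\<^sup>2)
        ((\<bar>1 + t\<bar> * c / 2 + \<bar>1 - t\<bar> * c / 2) - \<bar>t\<bar> * c)"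
      unfolding c_def
      by (intro has_bochner_integral_diff has_bochner_integral_add has_bochner_integral_divide_zero
          cos_diff_quotient_integral)
    moreover have "(\<bar>1 + t\<bar> * c / 2 + \<bar>1 - t\<bar> * c / 2) - \<bar>t\<bar> * c = 0"
    proof -
      have "\<bar>1 + t\<bar> + \<bar>1 - t\<bar> = 2 * \<bar>t\<bar>" using assms by arith
      then have "(\<bar>1 + t\<bar> + \<bar>1 - t\<bar>) * c / 2 - \<bar>t\<bar> * c = 0" by simp
      then show ?thesis by (simp add: field_simps)
    qed
    moreover have "((1 - cos ((1 + t) * x)) / x\<^sup>2 / 2 + (1 - cos ((1 - t) * x)) / x\<^sup>2 / 2) - (1 - cos (t * x)) / x\<^sup>2
        = fejer x * cos (t * x)" for x
      unfolding fejer_def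
      by (cases "x = 0") (simp_all add: field_simps cos_add cos_diff)
    ultimately show ?thesis by simp
  qed
  have sin_int: "integrable lborel (\<lambda>x. fejer x * sin (t * x))"
    by (rule Bochner_Integration.integrable_bound[OF integrable_fejer])
      (auto simp: fejer_nonneg abs_mult intro!: AE_I2 mult_left_le)
  \<comment> \<open>The integrand is odd; the substitution \<open>x = - y\<close> shows that the
    integral equals its negative.\<close>
  have "(\<integral>x. fejer x * sin (t * x) \<partial>lborel) = (\<integral>x. fejer (0 + (-1) * x) * sin (t * (0 + (-1) * x)) \<partial>lborel)"
    by (subst lborel_integral_real_affine[of "-1" _ 0]) auto
  also have "\<dots> = - (\<integral>x. fejer x * sin (t * x) \<partial>lborel)"
    by (simp add: fejer_def)
  finally have "(\<integral>x. fejer x * sin (t * x) \<partial>lborel) = 0" by simp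
  with sin_int have int_sin: "has_bochner_integral lborel (\<lambda>x. fejer x * sin (t * x)) 0"
    by (simp add: has_bochner_integral_iff)
  have "char fejer_distribution t = (\<integral>x. (fejer x / c) *\<^sub>R iexp (t * x) \<partial>lborel)"
    unfolding char_def fejer_distribution_def c_def[symmetric] using c
    by (intro integral_density) (auto simp: fejer_nonneg)
  also have "(\<lambda>x. (fejer x / c) *\<^sub>R iexp (t * x))
      = (\<lambda>x. of_real (fejer x * cos (t * x) / c) + \<i> * of_real (fejer x * sin (t * x) / c))"
    by (auto simp: complex_eq_iff Re_exp Im_exp)
  also have "(\<integral>x. of_real (fejer x * cos (t * x) / c) + \<i> * of_real (fejer x * sin (t * x) / c) \<partial>lborel)
      = (\<integral>x. complex_of_real (fejer x * cos (t * x) / c) \<partial>lborel)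
       + (\<integral>x. \<i> * of_real (fejer x * sin (t * x) / c) \<partial>lborel)"
    using int_cos int_sin
    by (intro Bochner_Integration.integral_add integrable_mult_right integrable_of_real integrable_divide)
      (auto simp: has_bochner_integral_iff)
  also have "\<dots> = 0"
    using int_cos int_sin by (simp add: has_bochner_integral_iff del: of_real_mult of_real_divide)
  finally show ?thesis .
qed

section \<open>Smoothing by convolution and inversion of characteristic functions\<close>

lemma char_convolution:
  assumes "real_distribution M" "real_distribution N"
  shows "char (M \<star> N) t = char M t * char N t"
proof -
  interpret M: real_distribution M by fact
  interpret N: real_distribution N by fact
  interpret P: pair_prob_space M N ..
  have "char (M \<star> N) t = (\<integral>p. iexp (t * (fst p + snd p)) \<partial>(M \<Otimes>\<^sub>M N))"
    unfolding char_def convolution_def by (subst integral_distr) (auto simp: case_prod_unfold)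
  also have "\<dots> = (\<integral>p. (case p of (x, y) \<Rightarrow> iexp (t * x) * iexp (t * y)) \<partial>(M \<Otimes>\<^sub>M N))"
    by (intro Bochner_Integration.integral_cong) (auto simp: algebra_simps exp_add)
  also have "\<dots> = (\<integral>x. \<integral>y. iexp (t * x) * iexp (t * y) \<partial>N \<partial>M)"
  proof -
    have "integrable (M \<Otimes>\<^sub>M N) (\<lambda>(x, y). iexp (t * x) * iexp (t * y))"
      by (rule P.integrable_const_bound[where B=1]) (auto simp: norm_mult)
    from P.integral_fst[OF this] show ?thesis by simp
  qed
  also have "\<dots> = char M t * char N t"
    by (simp add: char_def)
  finally show ?thesis .
qed

lemma real_distribution_convolution:
  assumes "real_distribution M" "real_distribution N"
  shows "real_distribution (M \<star> N)"
proof -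
  interpret M: real_distribution M by fact
  interpret N: real_distribution N by fact
  interpret P: pair_prob_space M N ..
  show ?thesis
    unfolding convolution_def by (intro P.real_distribution_distr) simp
qed

lemma cdf_convolution:
  assumes "real_distribution M" "real_distribution N"
  shows "cdf (M \<star> N) y = (\<integral>s. cdf N (y - s) \<partial>M)"
    and "integrable M (\<lambda>s. cdf N (y - s))"
proof -
  interpret M: real_distribution M by fact
  interpret N: real_distribution N by fact
  interpret C: real_distribution "M \<star> N"
    by (rule real_distribution_convolution) fact+
  have [measurable]: "cdf N \<in> borel_measurable borel"
    by (intro borel_measurable_mono monoI N.cdf_nondecreasing)
  show int: "integrable M (\<lambda>s. cdf N (y - s))"
    by (rule M.integrable_const_bound[where B=1]) (auto simp: N.cdf_nonneg N.cdf_bounded_prob)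
  have "ennreal (cdf (M \<star> N) y) = emeasure (M \<star> N) {..y}"
    by (simp add: cdf_def C.emeasure_eq_measure)
  also have "\<dots> = (\<integral>\<^sup>+s. emeasure N {a. a + s \<in> {..y}} \<partial>M)"
    by (rule convolution_emeasure)
      (auto intro: M.finite_measure_axioms N.finite_measure_axioms)
  also have "\<dots> = (\<integral>\<^sup>+s. ennreal (cdf N (y - s)) \<partial>M)"
  proof (rule nn_integral_cong)
    fix s
    have "{a. a + s \<in> {..y}} = {..y - s}" by auto
    then show "emeasure N {a. a + s \<in> {..y}} = ennreal (cdf N (y - s))"
      by (simp add: cdf_def N.emeasure_eq_measure)
  qed
  also have "\<dots> = ennreal (\<integral>s. cdf N (y - s) \<partial>M)"
    by (intro nn_integral_eq_integral int) (auto simp: N.cdf_nonneg)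
  finally show "cdf (M \<star> N) y = (\<integral>s. cdf N (y - s) \<partial>M)"
    by (simp add: C.cdf_nonneg N.cdf_nonneg integral_nonneg_AE)
qed

text \<open>Levy inversion is applied at points without mass. Smoothing by an atomless distribution
  ensures this even if the other one is discrete, as for tree sizes.\<close>

lemma measure_convolution_singleton:
  assumes "real_distribution M" "real_distribution N" "\<And>a. emeasure M {a} = 0"
  shows "measure (M \<star> N) {a} = 0"
proof -
  interpret M: real_distribution M by fact
  interpret N: real_distribution N by fact
  have "(M \<star> N) = (N \<star> M)"
    by (rule convolution_commutative) (auto intro: M.finite_measure_axioms N.finite_measure_axioms)
  moreover have "emeasure (N \<star> M) {a} = (\<integral>\<^sup>+s. emeasure M {x. x + s \<in> {a}} \<partial>N)"
    by (rule convolution_emeasure) (auto intro: M.finite_measure_axioms N.finite_measure_axioms)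
  moreover have "{x. x + s \<in> {a}} = {a - s}" for s by auto
  ultimately show ?thesis using assms(3) by (simp add: measure_def)
qed

text \<open>Levy inversion on \<open>{a<..b}\<close>: the kernel is at most
  \<open>2 / \<bar>t\<bar>\<close>, which cancels the factor \<open>\<bar>t\<bar>\<close> of the
  hypothesis, and \<open>2 / (2 * pi) \<le> 1\<close>. The bound does not depend on
  \<open>a\<close>, which then tends to minus infinity.\<close>

lemma cdf_diff_le_char_diff:
  fixes g :: "real \<Rightarrow> real"
  assumes "real_distribution M" "real_distribution N"
    and "\<And>a. measure M {a} = 0" "\<And>a. measure N {a} = 0"
    and g: "integrable lborel g" "\<And>t. g t \<ge> 0"
    and le: "\<And>t. cmod (char M t - char N t) \<le> \<bar>t\<bar> * g t"
  shows "\<bar>cdf M b - cdf N b\<bar> \<le> integral\<^sup>L lborel g"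
proof -
  interpret M: real_distribution M by fact
  interpret N: real_distribution N by fact
  have *: "\<bar>measure M {a<..b} - measure N {a<..b}\<bar> \<le> integral\<^sup>L lborel g" if "a \<le> b" for a
  proof -
    define F where "F = (\<lambda>t::real. (iexp (-(t * a)) - iexp (-(t * b))) / (\<i> * t))"
    \<comment> \<open>This bound serves integrability on bounded intervals; the quantitative
      estimate uses \<open>F_le'\<close>.\<close>
    have F_le: "cmod (F t) \<le> b - a" for t
      using Levy_Inversion_aux2[of "-b" "-a" t] that by (cases "t = 0") (simp_all add: F_def)
    have F_le': "cmod (F t) * \<bar>t\<bar> \<le> 2" for t
    proof -
      have "cmod (iexp (-(t * a)) - iexp (-(t * b))) \<le> 1 + 1"
        by (rule order.trans[OF norm_triangle_ineq4]) simp
      then show ?thesis by (simp add: F_def norm_divide norm_mult)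
    qed
    have [measurable]: "F \<in> borel_measurable borel"
      unfolding F_def by measurable
    have int: "integrable lborel (\<lambda>t. indicator {-S<..<S} t *\<^sub>R (F t * char L t))"
      if "real_distribution L" for L S
    proof -
      interpret L: real_distribution L by fact
      have bound: "cmod (F t * char L t) \<le> (b - a) * 1" for t
        unfolding norm_mult using F_le L.cmod_char_le_1 \<open>a \<le> b\<close> by (intro mult_mono) auto
      have "emeasure lborel {-S<..<S} < \<infinity>"
        by (cases "S \<ge> 0") auto
      then show ?thesis
        by (intro integrableI_bounded_set_indicator[where B="b - a"])
          (use bound in \<open>auto intro!: AE_I2\<close>)
    qed
    have eq: "(CLBINT t=-ereal S..ereal S. F t * char L t) = (\<integral>t. indicator {-S<..<S} t *\<^sub>R (F t * char L t) \<partial>lborel)"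
      if "S \<ge> 0" for L S
      using that unfolding interval_lebesgue_integral_def set_lebesgue_integral_def
      by simp
    have bound: "cmod (1 / (2 * pi) * (CLBINT t=-ereal (real n)..ereal (real n). F t * char M t)
        - 1 / (2 * pi) * (CLBINT t=-ereal (real n)..ereal (real n). F t * char N t)) \<le> integral\<^sup>L lborel g" for n
    proof -
      have "cmod ((CLBINT t=-ereal (real n)..ereal (real n). F t * char M t)
          - (CLBINT t=-ereal (real n)..ereal (real n). F t * char N t))
        = cmod (\<integral>t. indicator {-real n<..<real n} t *\<^sub>R (F t * char M t)
            - indicator {-real n<..<real n} t *\<^sub>R (F t * char N t) \<partial>lborel)"
        by (subst (1 2) eq; simp?)
          (subst Bochner_Integration.integral_diff; (rule int)?; (fact | simp))
      also have "\<dots> \<le> (\<integral>t. 2 * g t \<partial>lborel)"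
      proof (rule Bochner_Integration.integral_norm_bound_integral)
        show "integrable lborel (\<lambda>t. indicator {-real n<..<real n} t *\<^sub>R (F t * char M t)
            - indicator {-real n<..<real n} t *\<^sub>R (F t * char N t))"
          by (intro Bochner_Integration.integrable_diff int) fact+
        show "integrable lborel (\<lambda>t. 2 * g t)" using g by simp
        fix t
        have "cmod (F t * char M t - F t * char N t) = cmod (F t) * cmod (char M t - char N t)"
          by (simp add: norm_mult flip: right_diff_distrib)
        also have "\<dots> \<le> cmod (F t) * (\<bar>t\<bar> * g t)"
          by (intro mult_left_mono le) auto
        also have "\<dots> \<le> 2 * g t"
          using mult_right_mono[OF F_le'[of t] g(2)[of t]] by (simp add: mult_ac)
        finally show "cmod (indicator {-real n<..<real n} t *\<^sub>R (F t * char M t)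
            - indicator {-real n<..<real n} t *\<^sub>R (F t * char N t)) \<le> 2 * g t"
          using g(2)[of t] by (auto split: split_indicator)
      qed
      finally have "cmod ((CLBINT t=-ereal (real n)..ereal (real n). F t * char M t)
          - (CLBINT t=-ereal (real n)..ereal (real n). F t * char N t)) \<le> 2 * integral\<^sup>L lborel g"
        by simp
      then have "1 / (2 * pi) * cmod ((CLBINT t=-ereal (real n)..ereal (real n). F t * char M t)
          - (CLBINT t=-ereal (real n)..ereal (real n). F t * char N t)) \<le> 1 / (2 * pi) * (2 * integral\<^sup>L lborel g)"
        by (intro mult_left_mono) auto
      also have "\<dots> \<le> 1 * integral\<^sup>L lborel g"
        using pi_ge_two g integral_nonneg_AE[of g lborel]
          mult_right_mono[of 1 pi "integral\<^sup>L lborel g"]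
        by (simp add: field_simps)
      finally show ?thesis
        by (simp add: norm_divide norm_mult flip: diff_divide_distrib)
    qed
    have lim: "(\<lambda>n. 1 / (2 * pi) * (CLBINT t=-ereal (real n)..ereal (real n). F t * char L t))
        \<longlonglongrightarrow> of_real (measure L {a<..b})"
      if "real_distribution L" "\<And>a. measure L {a} = 0" for L
      using real_distribution.Levy_Inversion[OF that(1) \<open>a \<le> b\<close> that(2) that(2)] by (simp add: F_def)
    have "(\<lambda>n. 1 / (2 * pi) * (CLBINT t=-ereal (real n)..ereal (real n). F t * char M t)
        - 1 / (2 * pi) * (CLBINT t=-ereal (real n)..ereal (real n). F t * char N t))
        \<longlonglongrightarrow> of_real (measure M {a<..b}) - of_real (measure N {a<..b})"
      using assms by (intro tendsto_diff lim) auto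
    then have "cmod (of_real (measure M {a<..b}) - of_real (measure N {a<..b})) \<le> integral\<^sup>L lborel g"
      by (rule Lim_norm_ubound[rotated]) (use bound in auto)
    then show ?thesis by (simp flip: of_real_diff)
  qed
  have "((\<lambda>a. \<bar>(cdf M b - cdf M a) - (cdf N b - cdf N a)\<bar>) \<longlongrightarrow> \<bar>(cdf M b - 0) - (cdf N b - 0)\<bar>) at_bot"
    by (intro tendsto_intros M.cdf_lim_at_bot N.cdf_lim_at_bot)
  moreover have "eventually (\<lambda>a. \<bar>(cdf M b - cdf M a) - (cdf N b - cdf N a)\<bar> \<le> integral\<^sup>L lborel g) at_bot"
    using eventually_le_at_bot[of "b - 1"]
  proof eventually_elim
    case (elim a)
    then have "a < b" by simp
    then show ?case
      using *[of a] by (simp add: M.cdf_diff_eq N.cdf_diff_eq)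
  qed
  ultimately have "\<bar>(cdf M b - 0) - (cdf N b - 0)\<bar> \<le> integral\<^sup>L lborel g"
    by (rule tendsto_upperbound) simp
  then show ?thesis by simp
qed

text \<open>
  Near a point where \<open>\<bar>cdf M - cdf N\<bar>\<close> almost attains its supremum, monotonicity of \<open>cdf M\<close> keeps the
  difference large on a one-sided interval of length \<open>2 * \<delta>\<close>, which catches most of the mass of \<open>V\<close>.
\<close>

lemma cdf_diff_le_smoothed:
  fixes \<beta> \<delta> m :: real
  assumes "real_distribution M" "real_distribution N" "real_distribution V"
    and "\<delta> \<ge> 0" "m \<ge> 0" and V: "measure V {-\<delta>..\<delta>} \<ge> 3 / 4"
    and smoothed: "\<And>y. \<bar>cdf (V \<star> M) y - cdf (V \<star> N) y\<bar> \<le> \<beta>"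
    and Lipschitz: "\<And>x y. x \<le> y \<Longrightarrow> cdf N y - cdf N x \<le> m * (y - x)"
  shows "\<bar>cdf M x - cdf N x\<bar> \<le> 2 * \<beta> + 4 * m * \<delta>"
proof -
  interpret M: real_distribution M by fact
  interpret N: real_distribution N by fact
  interpret V: real_distribution V by fact
  define H where "H y = cdf M y - cdf N y" for y
  define \<eta> where "\<eta> = (SUP y. \<bar>H y\<bar>)"
  have H_le_1: "\<bar>H y\<bar> \<le> 1" for y
    using M.cdf_nonneg[of y] N.cdf_nonneg[of y] M.cdf_bounded_prob[of y] N.cdf_bounded_prob[of y]
    unfolding H_def by linarith
  have bdd: "bdd_above (range (\<lambda>y. \<bar>H y\<bar>))"
    using H_le_1 by (auto intro!: bdd_aboveI)
  have H_le: "\<bar>H y\<bar> \<le> \<eta>" for y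
    unfolding \<eta>_def using bdd by (intro cSUP_upper) auto
  have int: "integrable V (\<lambda>s. H (y - s))" for y
    unfolding H_def by (intro Bochner_Integration.integrable_diff cdf_convolution) fact+
  have smooth: "\<bar>\<integral>s. H (y - s) \<partial>V\<bar> \<le> \<beta>" for y
    using smoothed[of y] unfolding H_def
    by (subst Bochner_Integration.integral_diff)
      (simp_all add: cdf_convolution[OF assms(3) assms(1)] cdf_convolution[OF assms(3) assms(2)])
  define p where "p = measure V {-\<delta>..\<delta>}"
  have p: "3 / 4 \<le> p" "p \<le> 1"
    using V by (auto simp: p_def)
  \<comment> \<open>On the window, of mass \<open>p\<close>, the integrand is at least
    \<open>h\<close>; outside it only the trivial bound \<open>- \<eta>\<close> is
    available.\<close>
  have lower: "p * h - (1 - p) * \<eta> \<le> (\<integral>s. f s \<partial>V)"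
    if "integrable V f" "\<And>s. s \<in> {-\<delta>..\<delta>} \<Longrightarrow> h \<le> f s" "\<And>s. \<bar>f s\<bar> \<le> \<eta>" for f h
  proof -
    have "p * h - (1 - p) * \<eta> = (\<integral>s. indicator {-\<delta>..\<delta>} s * (h + \<eta>) - \<eta> \<partial>V)"
      by (subst Bochner_Integration.integral_diff)
        (simp_all add: p_def V.prob_space[unfolded V.space_eq_univ] algebra_simps V.emeasure_eq_measure)
    also have "\<dots> \<le> (\<integral>s. f s \<partial>V)"
    proof (rule integral_mono)
      show "integrable V (\<lambda>s. indicator {-\<delta>..\<delta>} s * (h + \<eta>) - \<eta>)"
        by (intro Bochner_Integration.integrable_diff) (auto simp: V.emeasure_eq_measure)
      fix s
      show "indicator {-\<delta>..\<delta>} s * (h + \<eta>) - \<eta> \<le> f s"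
        using that(2)[of s] that(3)[of s] by (auto split: split_indicator)
    qed fact
    finally show ?thesis .
  qed
  have H_le': "3 / 4 * \<bar>H y\<bar> \<le> \<beta> + 2 * m * \<delta> + \<eta> / 4" for y
  proof -
    have fin: ?thesis if "p * (\<bar>H y\<bar> - 2 * m * \<delta>) - (1 - p) * \<eta> \<le> \<beta>"
    proof -
      have "3 / 4 * \<bar>H y\<bar> \<le> p * \<bar>H y\<bar>" using p by (intro mult_right_mono) auto
      moreover have "p * (2 * m * \<delta>) \<le> 1 * (2 * m * \<delta>)"
        using p assms(4,5) by (intro mult_right_mono) auto
      moreover have "(1 - p) * \<eta> \<le> 1 / 4 * \<eta>"
        using p H_le[of y] by (intro mult_right_mono) auto
      ultimately show ?thesis using that by (simp add: algebra_simps)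
    qed
    show ?thesis
    proof (cases "H y \<ge> 0")
      case True
      have "p * (\<bar>H y\<bar> - 2 * m * \<delta>) - (1 - p) * \<eta> \<le> (\<integral>s. H (y + \<delta> - s) \<partial>V)"
      proof (rule lower)
        fix s assume "s \<in> {-\<delta>..\<delta>}"
        then have s: "y \<le> y + \<delta> - s" "y + \<delta> - s - y \<le> 2 * \<delta>" by auto
        have "cdf N (y + \<delta> - s) - cdf N y \<le> m * (2 * \<delta>)"
          by (rule order.trans[OF Lipschitz[OF s(1)]]) (use s assms(5) in \<open>intro mult_left_mono, auto\<close>)
        then show "\<bar>H y\<bar> - 2 * m * \<delta> \<le> H (y + \<delta> - s)"
          using M.cdf_nondecreasing[OF s(1)] True by (simp add: H_def)
      qed (auto intro: int H_le)
      with smooth[of "y + \<delta>"] show ?thesis by (intro fin) linarith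
    next
      case False
      have "p * (\<bar>H y\<bar> - 2 * m * \<delta>) - (1 - p) * \<eta> \<le> (\<integral>s. - H (y - \<delta> - s) \<partial>V)"
      proof (rule lower)
        fix s assume "s \<in> {-\<delta>..\<delta>}"
        then have s: "y - \<delta> - s \<le> y" "y - (y - \<delta> - s) \<le> 2 * \<delta>" by auto
        have "cdf N y - cdf N (y - \<delta> - s) \<le> m * (2 * \<delta>)"
          by (rule order.trans[OF Lipschitz[OF s(1)]]) (use s assms(5) in \<open>intro mult_left_mono, auto\<close>)
        then show "\<bar>H y\<bar> - 2 * m * \<delta> \<le> - H (y - \<delta> - s)"
          using M.cdf_nondecreasing[OF s(1)] False by (simp add: H_def)
      qed (auto intro: int H_le)
      with smooth[of "y - \<delta>"] show ?thesis by (intro fin) simp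
    qed
  qed
  \<comment> \<open>The supremum over \<open>y\<close> yields an inequality for
    \<open>\<eta>\<close> in terms of itself with factor 1/3 on the right. As \<open>\<eta>\<close>
    is finite, it can be solved and gives \<open>2 * \<beta> + 4 * m * \<delta>\<close>.\<close>
  have "\<bar>H y\<bar> \<le> 4 / 3 * (\<beta> + 2 * m * \<delta> + \<eta> / 4)" for y
    using H_le'[of y] by (simp add: field_simps)
  then have "\<eta> \<le> 4 / 3 * (\<beta> + 2 * m * \<delta> + \<eta> / 4)"
    unfolding \<eta>_def by (intro cSUP_least) auto
  then show ?thesis
    using H_le[of x] unfolding H_def by (simp add: field_simps)
qed

text \<open>Smoothing at scale \<open>1 / T\<close> costs a term of order \<open>m / T\<close> and
  makes frequencies beyond \<open>T\<close> irrelevant. The integral of the difference quotient at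
  the origin is replaced by an integrable majorant \<open>g\<close>. The constant \<open>A\<close>
  is chosen before the distributions, hence universal.\<close>

theorem Esseen_smoothing:
  obtains A :: real where
    "A \<ge> 0"
    "\<And>M N T m g x. \<lbrakk>real_distribution M; real_distribution N; T > 0; m \<ge> 0;
        \<And>x y. x \<le> y \<Longrightarrow> cdf N y - cdf N x \<le> m * (y - x);
        integrable lborel g; \<And>t. g t \<ge> 0;
        \<And>t. \<bar>t\<bar> \<le> T \<Longrightarrow> cmod (char M t - char N t) \<le> \<bar>t\<bar> * g t\<rbrakk>
      \<Longrightarrow> \<bar>cdf M x - cdf N x\<bar> \<le> 2 * integral\<^sup>L lborel g + A * m / T"
proof -
  interpret V: real_distribution fejer_distribution
    by (rule real_distribution_fejer)
  obtain a where a: "a \<ge> 0" "measure fejer_distribution {-a..a} \<ge> 3 / 4"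
  proof -
    have "((\<lambda>a. cdf fejer_distribution a - cdf fejer_distribution (-a)) \<longlongrightarrow> 1 - 0) at_top"
      by (intro tendsto_diff V.cdf_lim_at_top_prob filterlim_compose[OF V.cdf_lim_at_bot filterlim_uminus_at_bot_at_top])
    then have "eventually (\<lambda>a. cdf fejer_distribution a - cdf fejer_distribution (-a) > 3 / 4) at_top"
      by (rule order_tendstoD) simp
    then have "eventually (\<lambda>a. cdf fejer_distribution a - cdf fejer_distribution (-a) > 3 / 4 \<and> a > 0) at_top"
      using eventually_gt_at_top by (rule eventually_conj)
    then obtain a where a: "cdf fejer_distribution a - cdf fejer_distribution (-a) > 3 / 4" "a > 0"
      unfolding eventually_at_top_linorder by blast
    then have "measure fejer_distribution {-a<..a} > 3 / 4"
      by (simp add: V.cdf_diff_eq)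
    moreover have "measure fejer_distribution {-a<..a} \<le> measure fejer_distribution {-a..a}"
      by (intro V.finite_measure_mono) auto
    ultimately show ?thesis using that[of a] a by linarith
  qed
  show ?thesis
  proof (rule that[of "4 * a"])
    fix M N :: "real measure" and T m :: real and g :: "real \<Rightarrow> real" and x
    assume M: "real_distribution M" and N: "real_distribution N" and "T > 0" "m \<ge> 0"
      and Lipschitz: "\<And>x y. x \<le> y \<Longrightarrow> cdf N y - cdf N x \<le> m * (y - x)"
      and g: "integrable lborel g" "\<And>t. g t \<ge> 0"
      and le: "\<And>t. \<bar>t\<bar> \<le> T \<Longrightarrow> cmod (char M t - char N t) \<le> \<bar>t\<bar> * g t"
    \<comment> \<open>Scaling by \<open>1 / T\<close> stretches the support of the characteristic
      function to \<open>[-T, T]\<close> and shrinks the window of mass at least 3/4 to half-width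
      \<open>a / T\<close>.\<close>
    define V where "V = distr fejer_distribution borel (\<lambda>x. x / T)"
    have rV: "real_distribution V"
      unfolding V_def by (intro V.real_distribution_distr) simp
    interpret VT: real_distribution V by (rule rV)
    have "char V t = char fejer_distribution (t / T)" for t
      unfolding V_def char_def by (subst integral_distr) auto
    then have char_V: "char V t = 0" if "\<bar>t\<bar> > T" for t
      using that \<open>T > 0\<close> by (simp add: char_fejer_eq_0)
    have V0: "emeasure V {b} = 0" for b
    proof -
      have "(\<lambda>x. x / T) -` {b} \<inter> space fejer_distribution = {b * T}"
        using \<open>T > 0\<close> by auto
      then show ?thesis
        unfolding V_def by (subst emeasure_distr) (auto simp: emeasure_fejer_singleton)
    qed
    have *: "cmod (char (V \<star> M) t - char (V \<star> N) t) \<le> \<bar>t\<bar> * g t" for t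
    proof (cases "\<bar>t\<bar> \<le> T")
      case True
      have "char (V \<star> M) t - char (V \<star> N) t = char V t * (char M t - char N t)"
        by (simp add: char_convolution rV M N algebra_simps)
      also have "cmod \<dots> \<le> 1 * cmod (char M t - char N t)"
        unfolding norm_mult by (intro mult_right_mono VT.cmod_char_le_1) auto
      also have "\<dots> \<le> \<bar>t\<bar> * g t" using le[OF True] by simp
      finally show ?thesis .
    next
      case False
      then show ?thesis using g(2)[of t] by (simp add: char_convolution rV M N char_V)
    qed
    have "(\<lambda>x. x / T) -` {-(a / T)..a / T} \<inter> space fejer_distribution = {-a..a}"
      using \<open>T > 0\<close> by (auto simp: field_simps)
    then have "measure V {-(a / T)..a / T} \<ge> 3 / 4"
      using a(2) unfolding V_def by (subst measure_distr) auto
    moreover have "\<bar>cdf (V \<star> M) y - cdf (V \<star> N) y\<bar> \<le> integral\<^sup>L lborel g" for y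
      by (rule cdf_diff_le_char_diff)
        (use M N rV V0 g * in \<open>auto intro: real_distribution_convolution measure_convolution_singleton\<close>)
    ultimately have "\<bar>cdf M x - cdf N x\<bar> \<le> 2 * integral\<^sup>L lborel g + 4 * m * (a / T)"
      using a(1) \<open>T > 0\<close> \<open>m \<ge> 0\<close> Lipschitz
      by (intro cdf_diff_le_smoothed[OF M N rV]) auto
    then show "\<bar>cdf M x - cdf N x\<bar> \<le> 2 * integral\<^sup>L lborel g + 4 * a * m / T"
      by (simp add: mult_ac)
  qed (use a in auto)
qed

section \<open>Quasi-powers\<close>

lemma cdf_std_normal_Lipschitz:
  assumes "x \<le> y"
  shows "cdf std_normal_distribution y - cdf std_normal_distribution x \<le> 1 * (y - x)"
proof -
  interpret N: real_distribution std_normal_distribution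
    by (rule real_dist_normal_dist)
  have le1: "std_normal_density t \<le> 1" for t
  proof -
    have "1 \<le> sqrt (2 * pi)" using pi_ge_two by (simp add: real_le_rsqrt)
    moreover have "exp (- t\<^sup>2 / 2) \<le> 1" by simp
    ultimately show ?thesis
      unfolding std_normal_density_def using mult_mono[of "1 / sqrt (2 * pi)" 1 "exp (- t\<^sup>2 / 2)" 1] by simp
  qed
  have "cdf std_normal_distribution y - cdf std_normal_distribution x = measure std_normal_distribution {x<..y}"
    using assms by (cases "x = y") (auto simp: N.cdf_diff_eq)
  also have "ennreal \<dots> = (\<integral>\<^sup>+t. ennreal (std_normal_density t) * indicator {x<..y} t \<partial>lborel)"
    by (subst N.emeasure_eq_measure[symmetric]) (simp add: emeasure_density)
  also have "\<dots> \<le> (\<integral>\<^sup>+t. indicator {x<..y} t \<partial>lborel)"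
    using le1 by (intro nn_integral_mono) (auto split: split_indicator)
  also have "\<dots> = ennreal (y - x)" using assms by simp
  finally show ?thesis using assms by simp
qed

lemma cdf_std_normal_eq:
  "cdf std_normal_distribution x = 1 / sqrt (2 * pi) * (LBINT t:{..x}. exp (- (t\<^sup>2) / 2))"
proof -
  interpret N: real_distribution std_normal_distribution
    by (rule real_dist_normal_dist)
  have "cdf std_normal_distribution x = (\<integral>t. indicator {..x} t \<partial>std_normal_distribution)"
    by (simp add: cdf_def)
  also have "\<dots> = (\<integral>t. std_normal_density t *\<^sub>R indicator {..x} t \<partial>lborel)"
    by (intro integral_density) auto
  also have "\<dots> = (\<integral>t. 1 / sqrt (2 * pi) * (indicator {..x} t *\<^sub>R exp (- (t\<^sup>2) / 2)) \<partial>lborel)"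
    by (intro Bochner_Integration.integral_cong) (auto simp: std_normal_density_def)
  also have "\<dots> = 1 / sqrt (2 * pi) * (LBINT t:{..x}. exp (- (t\<^sup>2) / 2))"
    unfolding set_lebesgue_integral_def by simp
  finally show ?thesis .
qed

text \<open>The majorant for Esseen's inequality; up to the factor \<open>sqrt (4 * pi)\<close> it
  combines the moments of order 2 and 0 of the normal law with variance 2.\<close>

lemma integrable_gaussian_quadratic: "integrable lborel (\<lambda>t::real. (t\<^sup>2 + 1) * exp (- t\<^sup>2 / 4))"
proof -
  have "integrable lborel (\<lambda>t::real. normal_density 0 (sqrt 2) t * (t - 0) ^ 2 + normal_density 0 (sqrt 2) t * (t - 0) ^ 0)"
    by (intro Bochner_Integration.integrable_add integrable_normal_moment) auto
  then have "integrable lborel (\<lambda>t::real. sqrt (4 * pi) * (normal_density 0 (sqrt 2) t * (t - 0) ^ 2 + normal_density 0 (sqrt 2) t * (t - 0) ^ 0))"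
    by (rule integrable_mult_right)
  also have "(\<lambda>t::real. sqrt (4 * pi) * (normal_density 0 (sqrt 2) t * (t - 0) ^ 2 + normal_density 0 (sqrt 2) t * (t - 0) ^ 0))
      = (\<lambda>t. (t\<^sup>2 + 1) * exp (- t\<^sup>2 / 4))"
    by (auto simp: normal_density_def field_simps)
  finally show ?thesis .
qed

lemma norm_exp_minus_1_le: "cmod (exp u - 1) \<le> cmod u * exp (cmod u)"
proof -
  have "cmod (exp u - exp 0) \<le> exp (cmod u) * cmod (u - 0)"
  proof (rule field_differentiable_bound[of "cball 0 (cmod u)"])
    fix z :: complex assume "z \<in> cball 0 (cmod u)"
    then show "cmod (exp z) \<le> exp (cmod u)"
      using complex_Re_le_cmod[of z] by simp
  qed (auto intro!: derivative_eq_intros)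
  then show ?thesis by (simp add: mult.commute)
qed

text \<open>At \<open>s = \<i> * t / (\<sigma> * sqrt n)\<close> the characteristic function is
  \<open>exp (- t\<^sup>2 / 2) * exp u * w\<close>, where \<open>u\<close> is \<open>n\<close> times
  the negated cubic remainder of \<open>\<phi>\<close> and \<open>w\<close> is the nearly constant
  factor. Both \<open>u\<close> and \<open>w - 1\<close> carry a factor
  \<open>\<bar>t\<bar> / sqrt n\<close>: the \<open>\<bar>t\<bar>\<close> is needed by Esseen's
  inequality, the rest is the rate.\<close>

theorem quasi_power_Berry_Esseen:
  fixes p :: "nat \<Rightarrow> 'a pmf" and X :: "'a \<Rightarrow> real" and \<phi> :: "complex \<Rightarrow> complex"
  assumes "\<sigma>2 > 0" "\<epsilon> > 0"
    and \<phi>: "\<And>s. s \<in> cball 0 \<epsilon> \<Longrightarrow> cmod (\<phi> s + of_real \<mu> * s + of_real \<sigma>2 * s\<^sup>2 / 2) \<le> B * cmod s ^ 3"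
    and W: "\<And>n s. n \<ge> 1 \<Longrightarrow> s \<in> cball 0 \<epsilon> \<Longrightarrow>
      cmod (measure_pmf.expectation (p n) (\<lambda>\<omega>. exp (s * of_real (X \<omega>))) * exp (of_nat n * \<phi> s) - 1) \<le> K * cmod s"
  shows "\<exists>C. \<forall>n\<ge>1. \<forall>x. \<bar>cdf (distr (measure_pmf (p n)) borel (\<lambda>\<omega>. (X \<omega> - \<mu> * real n) / sqrt (\<sigma>2 * real n))) x
      - cdf std_normal_distribution x\<bar> \<le> C / sqrt (real n)"
proof -
  obtain A where A: "A \<ge> 0"
    "\<And>M N T m g x. \<lbrakk>real_distribution M; real_distribution N; T > 0; m \<ge> 0;
        \<And>x y. x \<le> y \<Longrightarrow> cdf N y - cdf N x \<le> m * (y - x);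
        integrable lborel g; \<And>t. g t \<ge> 0;
        \<And>t. \<bar>t\<bar> \<le> T \<Longrightarrow> cmod (char M t - char N t) \<le> \<bar>t\<bar> * g t\<rbrakk>
      \<Longrightarrow> \<bar>cdf M x - cdf N x\<bar> \<le> 2 * integral\<^sup>L lborel g + A * m / T"
    using Esseen_smoothing by metis
  define \<sigma> where "\<sigma> = sqrt \<sigma>2"
  have \<sigma>: "\<sigma> > 0" "\<sigma>2 = \<sigma>\<^sup>2" using assms(1) by (auto simp: \<sigma>_def)
  define B' where "B' = max 1 B"
  have B': "B' \<ge> 1" "\<And>x. x \<ge> 0 \<Longrightarrow> B * x \<le> B' * x"
    by (auto simp: B'_def intro: mult_right_mono)
  have "0 \<le> K"
  proof -
    have "0 \<le> K * cmod (of_real \<epsilon>)"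
      by (rule order_trans[OF norm_ge_zero W[of 1]]) (use assms in auto)
    then show ?thesis using assms(2) by (simp add: zero_le_mult_iff)
  qed
  \<comment> \<open>For frequencies up to \<open>c * sqrt n\<close> the first entry keeps
    \<open>s\<close> in the disc of the hypotheses, and the second makes
    \<open>cmod u \<le> t\<^sup>2 / 4\<close>, so that a Gaussian factor
    \<open>exp (- t\<^sup>2 / 4)\<close> survives.\<close>
  define c where "c = min (\<sigma> * \<epsilon>) (\<sigma> ^ 3 / (4 * B'))"
  have c: "c > 0" "c / \<sigma> \<le> \<epsilon>" "B' * c / \<sigma> ^ 3 \<le> 1 / 4"
  proof -
    show "c > 0" using \<sigma> assms(2) B' by (simp add: c_def)
    have "c \<le> \<sigma> * \<epsilon>" by (simp add: c_def)
    then show "c / \<sigma> \<le> \<epsilon>" using \<sigma> by (simp add: pos_divide_le_eq mult.commute)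
    have "c \<le> \<sigma> ^ 3 / (4 * B')" by (simp add: c_def)
    then show "B' * c / \<sigma> ^ 3 \<le> 1 / 4" using \<sigma> B' by (simp add: field_simps)
  qed
  define E where "E = B' / \<sigma> ^ 3 * (1 + K * \<epsilon>) + K / \<sigma>"
  have "E \<ge> 0" using B' \<sigma> \<open>0 \<le> K\<close> assms(2) by (simp add: E_def)
  define J :: real where "J = (\<integral>t. (t\<^sup>2 + 1) * exp (- t\<^sup>2 / 4) \<partial>lborel)"
  have "\<bar>cdf (distr (measure_pmf (p n)) borel (\<lambda>\<omega>. (X \<omega> - \<mu> * real n) / sqrt (\<sigma>2 * real n))) x
      - cdf std_normal_distribution x\<bar> \<le> (2 * E * J + A / c) / sqrt (real n)" if n: "n \<ge> 1" for n x
  proof -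
    define rn where "rn = sqrt (real n)"
    have rn: "rn > 0" "real n = rn\<^sup>2" using n by (auto simp: rn_def)
    define M where "M = distr (measure_pmf (p n)) borel (\<lambda>\<omega>. (X \<omega> - \<mu> * real n) / sqrt (\<sigma>2 * real n))"
    have sqrt: "sqrt (\<sigma>2 * real n) = \<sigma> * rn"
      by (simp add: \<sigma>_def rn_def real_sqrt_mult)
    have rM: "real_distribution M"
      unfolding M_def by (intro prob_space.real_distribution_distr prob_space_measure_pmf) simp
    have char_le: "cmod (char M t - char std_normal_distribution t)
        \<le> \<bar>t\<bar> * (E / rn * ((t\<^sup>2 + 1) * exp (- t\<^sup>2 / 4)))" if t: "\<bar>t\<bar> \<le> c * rn" for t
    proof -
      define s where "s = \<i> * of_real (t / (\<sigma> * rn))"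
      have cmod_s: "cmod s = \<bar>t\<bar> / (\<sigma> * rn)"
        unfolding s_def norm_mult norm_of_real using \<sigma>(1) rn(1) by (simp add: abs_divide abs_mult)
      have "\<bar>t\<bar> / (\<sigma> * rn) \<le> (c * rn) / (\<sigma> * rn)"
        using t \<sigma> rn by (intro divide_right_mono) auto
      also have "\<dots> = c / \<sigma>" using rn by simp
      finally have s: "s \<in> cball 0 \<epsilon>" and s_le: "cmod s \<le> \<epsilon>"
        using c(2) cmod_s by auto
      define w where "w = measure_pmf.expectation (p n) (\<lambda>\<omega>. exp (s * of_real (X \<omega>))) * exp (of_nat n * \<phi> s)"
      have w: "cmod (w - 1) \<le> K * cmod s" unfolding w_def by (rule W[OF n s])
      define \<delta> where "\<delta> = \<phi> s + of_real \<mu> * s + of_real \<sigma>2 * s\<^sup>2 / 2"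
      have "cmod \<delta> \<le> B' * cmod s ^ 3"
        using \<phi>[OF s] B'(2)[of "cmod s ^ 3"] unfolding \<delta>_def by simp
      then have "cmod (of_nat n * \<delta>) \<le> real n * (B' * cmod s ^ 3)"
        unfolding norm_mult by (simp add: mult_left_mono)
      also have "\<dots> = B' / \<sigma> ^ 3 * \<bar>t\<bar> ^ 3 / rn"
        using \<sigma> rn(1) by (simp add: cmod_s rn(2) field_simps power2_eq_square power3_eq_cube)
      finally have n\<delta>: "cmod (of_nat n * \<delta>) \<le> B' / \<sigma> ^ 3 * \<bar>t\<bar> ^ 3 / rn" .
      also have "\<dots> = (B' / \<sigma> ^ 3 * t\<^sup>2 / rn) * \<bar>t\<bar>"
        by (simp add: power3_eq_cube power2_eq_square)
      also have "\<dots> \<le> (B' / \<sigma> ^ 3 * t\<^sup>2 / rn) * (c * rn)"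
        using t B' \<sigma> rn by (intro mult_left_mono) auto
      also have "\<dots> = (B' * c / \<sigma> ^ 3) * t\<^sup>2" using rn by simp
      also have "\<dots> \<le> 1 / 4 * t\<^sup>2" using c(3) by (intro mult_right_mono) auto
      finally have n\<delta>': "cmod (of_nat n * \<delta>) \<le> t\<^sup>2 / 4" by simp
      have s2: "of_nat n * (of_real \<sigma>2 * s\<^sup>2 / 2) = - of_real (t\<^sup>2 / 2)"
      proof -
        have "s\<^sup>2 = - of_real ((t / (\<sigma> * rn))\<^sup>2)" unfolding s_def power_mult_distrib of_real_power by simp
        then have "of_nat n * (of_real \<sigma>2 * s\<^sup>2 / 2) = - complex_of_real (real n * (\<sigma>2 * (t / (\<sigma> * rn))\<^sup>2 / 2))"
          by simp
        moreover have "real n * (\<sigma>2 * (t / (\<sigma> * rn))\<^sup>2 / 2) = t\<^sup>2 / 2"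
          using \<sigma>(1) rn(1) unfolding \<sigma>(2) rn(2) by (simp add: power_mult_distrib power_divide)
        ultimately show ?thesis by (simp only:)
      qed
      have char_M: "char M t = of_real (exp (- t\<^sup>2 / 2)) * (exp (- (of_nat n * \<delta>)) * w)"
      proof -
        have "char M t = measure_pmf.expectation (p n) (\<lambda>\<omega>. iexp (t * ((X \<omega> - \<mu> * real n) / (\<sigma> * rn))))"
          unfolding M_def char_def sqrt by (subst integral_distr) auto
        also have "\<dots> = measure_pmf.expectation (p n) (\<lambda>\<omega>. exp (- (of_nat n * (of_real \<mu> * s))) * exp (s * of_real (X \<omega>)))"
          by (intro Bochner_Integration.integral_cong refl, subst exp_add[symmetric])
            (simp add: s_def diff_divide_distrib right_diff_distrib mult_ac)
        also have "\<dots> = exp (- (of_nat n * (of_real \<mu> * s))) * measure_pmf.expectation (p n) (\<lambda>\<omega>. exp (s * of_real (X \<omega>)))"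
          by simp
        also have "\<dots> = exp (- (of_nat n * (of_real \<mu> * s)) - of_nat n * \<phi> s) * w"
          unfolding w_def exp_diff by simp
        also have "- (of_nat n * (of_real \<mu> * s)) - of_nat n * \<phi> s
            = of_nat n * (of_real \<sigma>2 * s\<^sup>2 / 2) - of_nat n * \<delta>"
          by (simp add: \<delta>_def algebra_simps)
        also have "\<dots> = of_real (- t\<^sup>2 / 2) + - (of_nat n * \<delta>)"
          unfolding s2 by simp
        also have "exp \<dots> = of_real (exp (- t\<^sup>2 / 2)) * exp (- (of_nat n * \<delta>))"
          unfolding exp_add by (simp only: exp_of_real)
        finally show ?thesis by (simp only: mult.assoc)
      qed
      define u where "u = - (of_nat n * \<delta>)"
      have u: "cmod u \<le> B' / \<sigma> ^ 3 * \<bar>t\<bar> ^ 3 / rn" "cmod u \<le> t\<^sup>2 / 4"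
        using n\<delta> n\<delta>' by (auto simp: u_def)
      \<comment> \<open>Separates the error of the cubic remainder from that of the bounded
        factor.\<close>
      have "cmod (exp u * w - 1) = cmod ((exp u - 1) * w + (w - 1))"
        by (simp add: algebra_simps)
      also have "\<dots> \<le> cmod (exp u - 1) * cmod w + cmod (w - 1)"
        unfolding norm_mult[symmetric] by (rule norm_triangle_ineq)
      also have "\<dots> \<le> (cmod u * exp (cmod u)) * (1 + K * \<epsilon>) + K * cmod s"
      proof (intro add_mono mult_mono norm_exp_minus_1_le w)
        have "cmod w \<le> 1 + cmod (w - 1)" using norm_triangle_ineq[of 1 "w - 1"] by simp
        also have "\<dots> \<le> 1 + K * \<epsilon>"
          using w mult_left_mono[OF s_le \<open>0 \<le> K\<close>] by simp
        finally show "cmod w \<le> 1 + K * \<epsilon>" .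
      qed simp_all
      also have "\<dots> \<le> (B' / \<sigma> ^ 3 * \<bar>t\<bar> ^ 3 / rn * exp (t\<^sup>2 / 4)) * (1 + K * \<epsilon>) + K * (\<bar>t\<bar> / (\<sigma> * rn)) * exp (t\<^sup>2 / 4)"
      proof (rule add_mono)
        have "0 \<le> B' / \<sigma> ^ 3 * \<bar>t\<bar> ^ 3 / rn" "0 \<le> 1 + K * \<epsilon>"
          using B'(1) \<sigma>(1) rn(1) \<open>0 \<le> K\<close> assms(2) by simp_all
        then show "cmod u * exp (cmod u) * (1 + K * \<epsilon>) \<le> B' / \<sigma> ^ 3 * \<bar>t\<bar> ^ 3 / rn * exp (t\<^sup>2 / 4) * (1 + K * \<epsilon>)"
          using u by (intro mult_right_mono mult_mono) simp_all
        have "0 \<le> K * cmod s" using \<open>0 \<le> K\<close> by simp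
        then have "K * cmod s * 1 \<le> K * cmod s * exp (t\<^sup>2 / 4)"
          by (intro mult_left_mono) simp_all
        then show "K * cmod s \<le> K * (\<bar>t\<bar> / (\<sigma> * rn)) * exp (t\<^sup>2 / 4)"
          unfolding cmod_s by simp
      qed
      also have "\<dots> = \<bar>t\<bar> / rn * exp (t\<^sup>2 / 4) * (B' / \<sigma> ^ 3 * (1 + K * \<epsilon>) * t\<^sup>2 + K / \<sigma> * 1)"
        using \<sigma>(1) rn(1) by (simp add: power3_eq_cube power2_eq_square field_simps)
      also have "\<dots> \<le> \<bar>t\<bar> / rn * exp (t\<^sup>2 / 4) * (E * (t\<^sup>2 + 1))"
      proof (intro mult_left_mono)
        have "0 \<le> K / \<sigma> * t\<^sup>2" "0 \<le> B' / \<sigma> ^ 3 * (1 + K * \<epsilon>)"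
          using B'(1) \<sigma>(1) \<open>0 \<le> K\<close> assms(2) by simp_all
        then show "B' / \<sigma> ^ 3 * (1 + K * \<epsilon>) * t\<^sup>2 + K / \<sigma> * 1 \<le> E * (t\<^sup>2 + 1)"
          unfolding E_def distrib_left distrib_right by linarith
      qed (use rn in auto)
      finally have *: "cmod (exp u * w - 1) \<le> \<bar>t\<bar> / rn * exp (t\<^sup>2 / 4) * (E * (t\<^sup>2 + 1))" .
      have "char M t - char std_normal_distribution t = of_real (exp (- t\<^sup>2 / 2)) * (exp u * w - 1)"
        unfolding char_M char_std_normal_distribution u_def by (simp add: right_diff_distrib)
      then have "cmod (char M t - char std_normal_distribution t) = exp (- t\<^sup>2 / 2) * cmod (exp u * w - 1)"
        by (simp only: norm_mult norm_of_real) simp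
      also have "\<dots> \<le> exp (- t\<^sup>2 / 2) * (\<bar>t\<bar> / rn * exp (t\<^sup>2 / 4) * (E * (t\<^sup>2 + 1)))"
        by (intro mult_left_mono *) simp
      also have "\<dots> = (exp (- t\<^sup>2 / 2) * exp (t\<^sup>2 / 4)) * (\<bar>t\<bar> / rn * (E * (t\<^sup>2 + 1)))"
        by (simp only: mult_ac)
      also have "exp (- t\<^sup>2 / 2) * exp (t\<^sup>2 / 4) = exp (- t\<^sup>2 / 4)"
        unfolding exp_add[symmetric] by simp
      finally show ?thesis by (simp add: mult_ac)
    qed
    have "\<bar>cdf M x - cdf std_normal_distribution x\<bar>
        \<le> 2 * (\<integral>t. E / rn * ((t\<^sup>2 + 1) * exp (- t\<^sup>2 / 4)) \<partial>lborel) + A * 1 / (c * rn)"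
    proof (rule A(2)[OF rM real_dist_normal_dist])
      show "integrable lborel (\<lambda>t. E / rn * ((t\<^sup>2 + 1) * exp (- t\<^sup>2 / 4)))"
        by (intro integrable_mult_right integrable_gaussian_quadratic)
      show "E / rn * ((t\<^sup>2 + 1) * exp (- t\<^sup>2 / 4)) \<ge> 0" for t
        using \<open>E \<ge> 0\<close> rn by simp
    qed (use c rn char_le cdf_std_normal_Lipschitz in auto)
    also have "\<dots> = (2 * E * J + A / c) / rn"
      by (simp add: J_def add_divide_distrib)
    finally show ?thesis by (simp only: M_def rn_def)
  qed
  then show ?thesis by blast
qed

text \<open>The coefficient bound divided by the exact number of trees shows
  \<open>cmod (W n s) \<le> 2 * C\<close>, uniformly in \<open>n\<close>, since
  \<open>exp (\<phi> s)\<close> is four times the singularity. As \<open>W n\<close> is holomorphic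
  with \<open>W n 0 = 1\<close>, Cauchy's inequality for its derivative gives the last claim with
  \<open>K = 2 * C / \<epsilon>\<close>.\<close>

lemma cut_size_mgf:
  assumes "r \<ge> 1"
  defines "M \<equiv> \<lambda>n s. measure_pmf.expectation (random_plane_tree n) (\<lambda>t. exp (s * of_real (real (cut_size r t))))"
  obtains \<epsilon> \<phi> B K where "\<epsilon> > 0"
    "\<And>s. s \<in> cball 0 \<epsilon> \<Longrightarrow> cmod (\<phi> s + of_real (1 / (real r + 1)) * s
        + of_real (real r * (real r + 2) / (6 * (real r + 1)\<^sup>2)) * s\<^sup>2 / 2) \<le> B * cmod s ^ 3"
    "\<And>n s. n \<ge> 1 \<Longrightarrow> s \<in> cball 0 \<epsilon> \<Longrightarrow> cmod (M n s * exp (of_nat n * \<phi> s) - 1) \<le> K * cmod s"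
proof -
  obtain R C \<eta> where R: "R > 1/4" "C > 0" "\<eta> > 0" "low_tree_fun r holomorphic_on ball 0 R"
    and bound: "\<And>v \<rho> n. \<lbrakk>cmod (1 - v) \<le> \<eta>; cmod \<rho> < R; (1 - (1 - v) * low_tree_fun r \<rho>)\<^sup>2 = 4 * v * \<rho>; n \<ge> 1\<rbrakk>
      \<Longrightarrow> cmod (fps_nth (cut_size_gf r v) n) * cmod \<rho> ^ n \<le> C * cmod (1/2 gchoose n)"
    using cut_size_gf_bound[OF assms(1)] by metis
  obtain \<epsilon>0 \<phi> where \<epsilon>0: "\<epsilon>0 > 0" and \<phi>: "\<phi> holomorphic_on ball 0 \<epsilon>0" "\<phi> 0 = 0"
    and sing: "\<And>s. s \<in> ball 0 \<epsilon>0 \<Longrightarrow> cmod (exp (\<phi> s) / 4) < R"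
      "\<And>s. s \<in> ball 0 \<epsilon>0 \<Longrightarrow> (1 - (1 - exp s) * low_tree_fun r (exp (\<phi> s) / 4))\<^sup>2 = exp s * exp (\<phi> s)"
    using singularity_exists[OF assms(1) R(1)] by metis
  have "isCont (\<lambda>s::complex. exp s) 0" by simp
  then obtain \<epsilon>1 where \<epsilon>1: "\<epsilon>1 > 0" "\<And>s::complex. cmod s < \<epsilon>1 \<Longrightarrow> cmod (exp s - 1) < \<eta>"
    using R(3) unfolding continuous_at_eps_delta by (auto simp: dist_norm)
  define \<epsilon>2 where "\<epsilon>2 = min \<epsilon>0 \<epsilon>1"
  have \<epsilon>2: "\<epsilon>2 > 0" "ball 0 \<epsilon>2 \<subseteq> ball (0 :: complex) \<epsilon>0"
    using \<epsilon>0 \<epsilon>1 by (auto simp: \<epsilon>2_def)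
  \<comment> \<open>Closed discs of radius \<open>\<epsilon>\<close> about points of
    \<open>cball 0 \<epsilon>\<close> stay within radius \<open>2 * \<epsilon>\<close>, hence in the
    open disc of radius \<open>\<epsilon>2\<close> where \<open>W n\<close> is bounded.\<close>
  define \<epsilon> where "\<epsilon> = \<epsilon>2 / 3"
  have \<epsilon>: "\<epsilon> > 0" "\<epsilon> < \<epsilon>0" using \<epsilon>2(1) by (auto simp: \<epsilon>_def \<epsilon>2_def)
  obtain B where Taylor: "\<And>s. s \<in> cball 0 \<epsilon> \<Longrightarrow>
      cmod (\<phi> s - (\<phi> 0 + deriv \<phi> 0 * s + deriv (deriv \<phi>) 0 * s\<^sup>2 / 2)) \<le> B * cmod s ^ 3"
    using holomorphic_Taylor_2[OF \<epsilon>0 \<phi>(1) \<epsilon>] by metis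
  have derivs: "deriv \<phi> 0 = - of_real (1 / (real r + 1))"
      "deriv (deriv \<phi>) 0 = - of_real (real r * (real r + 2) / (6 * (real r + 1)\<^sup>2))"
    by (rule singularity_derivs[OF \<epsilon>0 \<phi> R(4)]; erule sing)+
  define W where "W n s = M n s * exp (of_nat n * \<phi> s)" for n s
  have M_eq: "M n s = (\<Sum>t\<in>plane_trees n. exp (s * of_real (real (cut_size r t)))) / of_nat (card (plane_trees n))"
    if "n \<ge> 1" for n s
    unfolding M_def random_plane_tree_def
    using that by (subst integral_measure_pmf[OF finite_plane_trees])
      (auto simp: finite_plane_trees plane_trees_nonempty scaleR_conv_of_real sum_divide_distrib intro!: sum.cong)
  have W_hol: "W n holomorphic_on ball 0 \<epsilon>2" if "n \<ge> 1" for n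
    unfolding W_def M_eq[OF that] using plane_trees_nonempty[OF that] finite_plane_trees[of n]
    by (intro holomorphic_intros holomorphic_on_subset[OF \<phi>(1) \<epsilon>2(2)]) auto
  have W_0: "W n 0 = 1" if "n \<ge> 1" for n
    unfolding W_def M_eq[OF that] using plane_trees_nonempty[OF that] finite_plane_trees[of n]
    by (simp add: \<phi>(2))
  have W_le: "cmod (W n s) \<le> 2 * C" if n: "n \<ge> 1" and s: "s \<in> ball 0 \<epsilon>2" for n s
  proof -
    define N where "N = real (card (plane_trees n))"
    have N: "N > 0" "2 * N = 4 ^ n * cmod (1/2 gchoose n)"
      using plane_trees_nonempty[OF n] finite_plane_trees[of n] card_plane_trees[OF n]
      by (auto simp: N_def card_gt_0_iff)
    have "cmod (1 - exp s) \<le> \<eta>"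
      using \<epsilon>1(2)[of s] s by (simp add: \<epsilon>2_def norm_minus_commute)
    moreover have s0: "s \<in> ball 0 \<epsilon>0" using s \<epsilon>2(2) by blast
    moreover have "(1 - (1 - exp s) * low_tree_fun r (exp (\<phi> s) / 4))\<^sup>2 = 4 * exp s * (exp (\<phi> s) / 4)"
      using sing(2)[OF s0] by simp
    ultimately have "cmod (fps_nth (cut_size_gf r (exp s)) n) * cmod (exp (\<phi> s) / 4) ^ n \<le> C * cmod (1/2 gchoose n)"
      using sing(1)[OF s0] n by (intro bound) auto
    moreover have "fps_nth (cut_size_gf r (exp s)) n = M n s * of_real N"
    proof -
      have "exp (s * of_nat k) = exp s ^ k" for k
        by (metis exp_of_nat_mult mult.commute)
      then show ?thesis
        using N(1) by (simp add: M_eq[OF n] cut_size_gf_def tree_gf_def N_def)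
    qed
    moreover have "cmod (exp (\<phi> s) / 4) ^ n = cmod (exp (of_nat n * \<phi> s)) / 4 ^ n"
      by (simp add: norm_divide power_divide exp_of_nat_mult norm_power)
    ultimately have "cmod (W n s) * N / 4 ^ n \<le> C * cmod (1/2 gchoose n)"
      using N(1) by (simp add: W_def norm_mult mult_ac)
    then have "cmod (W n s) * N \<le> C * (4 ^ n * cmod (1/2 gchoose n))"
      by (simp add: field_simps)
    also have "\<dots> = 2 * C * N" unfolding N(2)[symmetric] by simp
    finally show ?thesis using N(1) by simp
  qed
  have W_deriv_le: "cmod (deriv (W n) z) \<le> 2 * C / \<epsilon>" if n: "n \<ge> 1" and z: "z \<in> cball 0 \<epsilon>" for n z
  proof -
    have sub: "cball z \<epsilon> \<subseteq> ball 0 \<epsilon>2"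
    proof
      fix x assume "x \<in> cball z \<epsilon>"
      then show "x \<in> ball 0 \<epsilon>2"
        using z norm_triangle_ineq[of z "x - z"] \<epsilon>2(1) by (auto simp: \<epsilon>_def dist_norm norm_minus_commute)
    qed
    have "cmod ((deriv ^^ 1) (W n) z) \<le> fact 1 * (2 * C) / \<epsilon> ^ 1"
    proof (rule Cauchy_inequality)
      show "W n holomorphic_on ball z \<epsilon>"
        using W_hol[OF n] sub ball_subset_cball by (blast intro: holomorphic_on_subset)
      show "continuous_on (cball z \<epsilon>) (W n)"
        by (rule continuous_on_subset[OF holomorphic_on_imp_continuous_on[OF W_hol[OF n]] sub])
      show "cmod (W n x) \<le> 2 * C" if "cmod (z - x) = \<epsilon>" for x
        using that sub by (intro W_le[OF n]) (auto simp: dist_norm subset_iff)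
    qed (rule \<epsilon>)
    then show ?thesis by simp
  qed
  show ?thesis
  proof (rule that[of \<epsilon> \<phi> B "2 * C / \<epsilon>"])
    fix s :: complex assume s: "s \<in> cball 0 \<epsilon>"
    show "cmod (\<phi> s + of_real (1 / (real r + 1)) * s
        + of_real (real r * (real r + 2) / (6 * (real r + 1)\<^sup>2)) * s\<^sup>2 / 2) \<le> B * cmod s ^ 3"
      using Taylor[OF s] unfolding derivs \<phi>(2) by (simp only: add_0_left minus_mult_left[symmetric]
          minus_divide_left[symmetric] minus_add_distrib[symmetric] diff_minus_eq_add add.assoc)
    fix n :: nat assume n: "n \<ge> 1"
    have "cmod (W n s - W n 0) \<le> 2 * C / \<epsilon> * cmod (s - 0)"
    proof (rule field_differentiable_bound[of "cball 0 \<epsilon>"])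
      fix z :: complex assume z: "z \<in> cball 0 \<epsilon>"
      then have "z \<in> ball 0 \<epsilon>2" using \<epsilon>2(1) by (simp add: \<epsilon>_def)
      then show "(W n has_field_derivative deriv (W n) z) (at z within cball 0 \<epsilon>)"
        using holomorphic_derivI[OF W_hol[OF n] open_ball] by (blast intro: has_field_derivative_at_within)
      show "cmod (deriv (W n) z) \<le> 2 * C / \<epsilon>" by (rule W_deriv_le[OF n z])
    qed (use s \<epsilon>(1) in auto)
    then show "cmod (M n s * exp (of_nat n * \<phi> s) - 1) \<le> 2 * C / \<epsilon> * cmod s"
      by (simp add: W_0[OF n]) (simp add: W_def)
  qed (rule \<epsilon>)
qed

section \<open>From the rate to convergence in distribution, and the conclusion\<close>

lemma weak_conv_m_std_normalI:
  fixes M :: "nat \<Rightarrow> real measure"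
  assumes "\<And>n x. n \<ge> 1 \<Longrightarrow> \<bar>cdf (M n) x - cdf std_normal_distribution x\<bar> \<le> C / sqrt (real n)"
  shows "weak_conv_m M std_normal_distribution"
  unfolding weak_conv_m_def weak_conv_def
proof (intro allI impI)
  fix x
  have "(\<lambda>n. C / sqrt (real n)) \<longlonglongrightarrow> 0"
    by (intro tendsto_divide_0[OF tendsto_const] filterlim_at_top_imp_at_infinity
        filterlim_compose[OF sqrt_at_top filterlim_real_sequentially])
  then have "(\<lambda>n. cdf (M n) x - cdf std_normal_distribution x) \<longlonglongrightarrow> 0"
    by (rule Lim_null_comparison[rotated]) (use assms in \<open>auto intro!: eventually_sequentiallyI[of 1]\<close>)
  then show "(\<lambda>n. cdf (M n) x) \<longlonglongrightarrow> cdf std_normal_distribution x"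
    by (rule LIM_zero_cancel)
qed

theorem theorem2:
  fixes r :: nat and \<mu> \<sigma>2 :: real
  assumes "r \<ge> 1"
    and "\<mu> = 1 / (real r + 1)"
    and "\<sigma>2 = real r * (real r + 2) / (6 * (real r + 1)\<^sup>2)"
  shows
    "weak_conv_m
       (\<lambda>n. distr (measure_pmf (random_plane_tree n)) borel
              (\<lambda>t. (real (cut_size r t) - \<mu> * real n) / sqrt (\<sigma>2 * real n)))
       std_normal_distribution
     \<and> (\<exists>C. \<forall>n\<ge>1. \<forall>x::real.
          \<bar>measure_pmf.prob (random_plane_tree n)
              {t. (real (cut_size r t) - \<mu> * real n) / sqrt (\<sigma>2 * real n) \<le> x}
            - 1 / sqrt (2 * pi) * (LBINT t:{..x}. exp (- (t\<^sup>2) / 2))\<bar>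
          \<le> C * real n powr (- 1 / 2))
     \<and> weak_conv_m
       (\<lambda>n. distr (measure_pmf (random_plane_tree n)) borel
              (\<lambda>t. (real (cut_inner_nodes (r - 1) t) - \<mu> * real n) / sqrt (\<sigma>2 * real n)))
       std_normal_distribution
     \<and> (\<exists>C. \<forall>n\<ge>1. \<forall>x::real.
          \<bar>measure_pmf.prob (random_plane_tree n)
              {t. (real (cut_inner_nodes (r - 1) t) - \<mu> * real n) / sqrt (\<sigma>2 * real n) \<le> x}
            - 1 / sqrt (2 * pi) * (LBINT t:{..x}. exp (- (t\<^sup>2) / 2))\<bar>
          \<le> C * real n powr (- 1 / 2))"
proof -
  define M where "M n = distr (measure_pmf (random_plane_tree n)) borel
              (\<lambda>t. (real (cut_size r t) - \<mu> * real n) / sqrt (\<sigma>2 * real n))" for n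
  \<comment> \<open>The two random variables agree on every tree, so the last two claims are
    instances of the first two.\<close>
  have inner: "cut_inner_nodes (r - 1) = cut_size r"
    using assms(1) by (auto simp: cut_inner_nodes_eq_cut_size)
  have "\<sigma>2 > 0" using assms(1) by (simp add: assms(3))
  obtain C where C: "\<And>n x. n \<ge> 1 \<Longrightarrow> \<bar>cdf (M n) x - cdf std_normal_distribution x\<bar> \<le> C / sqrt (real n)"
  proof -
    obtain \<epsilon> \<phi> B K where "\<epsilon> > 0"
      "\<And>s. s \<in> cball 0 \<epsilon> \<Longrightarrow> cmod (\<phi> s + of_real \<mu> * s + of_real \<sigma>2 * s\<^sup>2 / 2) \<le> B * cmod s ^ 3"
      "\<And>n s. n \<ge> 1 \<Longrightarrow> s \<in> cball 0 \<epsilon> \<Longrightarrow>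
        cmod (measure_pmf.expectation (random_plane_tree n) (\<lambda>t. exp (s * of_real (real (cut_size r t))))
          * exp (of_nat n * \<phi> s) - 1) \<le> K * cmod s"
      using cut_size_mgf[OF assms(1)] unfolding assms(2,3) by metis
    from quasi_power_Berry_Esseen[OF \<open>\<sigma>2 > 0\<close> this] show ?thesis
      using that unfolding M_def by blast
  qed
  have weak: "weak_conv_m M std_normal_distribution"
    using C by (rule weak_conv_m_std_normalI)
  have "\<bar>measure_pmf.prob (random_plane_tree n)
          {t. (real (cut_size r t) - \<mu> * real n) / sqrt (\<sigma>2 * real n) \<le> x}
        - 1 / sqrt (2 * pi) * (LBINT t:{..x}. exp (- (t\<^sup>2) / 2))\<bar> \<le> C * real n powr (- 1 / 2)"
    if n: "n \<ge> 1" for n x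
  proof -
    have "real n powr (- 1 / 2) = 1 / sqrt (real n)"
      using n by (simp add: powr_minus powr_half_sqrt field_simps)
    moreover have "cdf (M n) x = measure_pmf.prob (random_plane_tree n)
          {t. (real (cut_size r t) - \<mu> * real n) / sqrt (\<sigma>2 * real n) \<le> x}"
      unfolding cdf_def M_def by (subst measure_distr) (auto intro!: arg_cong[where f = "measure _"])
    ultimately show ?thesis
      using C[OF n, of x] by (simp add: cdf_std_normal_eq)
  qed
  with weak show ?thesis
    unfolding inner M_def by blast
qed

end
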